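(* Let $m\geq 1$ and let $(V_l)_{l=1}^m$ be a family of $m$ finite sets with $\# V_l=d_ln_l+1$, where $d_l,n_l\geq 1$, $l=1,\ldots,m$, are positive integers. Write $n=n_1+\cdots+n_m$. Suppose that $$g:Y=\Delta(V_1)\times\cdots\times\Delta(V_m)\to Z$$ is a continuous map to a compact Hausdorff space $Z$ with covering dimension less than $n$. Then for some $l\in\{1,\ldots,m\}$ $$\bigcap_{T\in\mathcal S_{d_l}(V_l)} g\Bigl(\prod_{j<l}\Delta(V_j)\times\Delta_T\times\prod_{j>l}\Delta(V_j)\Bigr)\neq\emptyset.$$
   Context: For a finite set $V$: $\mathbb R[V]$ is the real vector space of maps $t:V\to\mathbb R$, and $\Delta(V)\subseteq\mathbb R[V]$ is the simplex of maps $t$ with $t(v)\geq 0$ for all $v\in V$ and $\sum_v t(v)=1$. The support of $t\in\mathbb R[V]$ is the set of $v\in V$ with $t(v)\neq 0$. For an integer $d$ with $0\leq d\leq\# V$, $\mathcal S_d(V)$ is the set of finite subsets $T$ of $\Delta(V)$ such that any two (distinct) elements of $T$ have disjoint supports and $\# V-\# T=d$. For $T\in\mathcal S_d(V)$, $\Delta_T$ denotes the convex hull of $T$; it is a simplex of codimension $d$ in $\Delta(V)$. A compact Hausdorff space $Z$ has covering dimension less than $n$ if every open cover of $Z$ can be refined by a finite open cover such that each point of $Z$ lies in at most $n$ of its members. *)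

theory Defs
  imports "HOL-Analysis.Analysis" "HOL-Library.Function_Algebras"
begin

text \<open>
  For a finite set \<open>V\<close>, a map \<open>t : V \<rightarrow> \<real>\<close> is represented by its extension by zero to the ambient
  type, so that \<open>\<real>[V]\<close> is a linear subspace of the space of all functions \<open>'v \<Rightarrow> real\<close>
  with the pointwise operations.  The pointwise (product) topology on \<open>'v \<Rightarrow> real\<close>, which is the
  one provided by the library, restricts to the Euclidean topology on \<open>\<real>[V]\<close>.
\<close>

instantiation "fun" :: (type, real_vector) real_vector
begin

definition scaleR_fun_def: "scaleR (r::real) f = (\<lambda>x. r *\<^sub>R f x)"

instance
  by standard (simp_all add: scaleR_fun_def fun_eq_iff scaleR_add_right scaleR_add_left)

end

definition real_space :: "'v set \<Rightarrow> ('v \<Rightarrow> real) set" where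
  "real_space V = {t. \<forall>v. v \<notin> V \<longrightarrow> t v = 0}"

definition supp :: "('v \<Rightarrow> real) \<Rightarrow> 'v set" where
  "supp t = {v. t v \<noteq> 0}"

definition std_simplex :: "'v set \<Rightarrow> ('v \<Rightarrow> real) set" where
  "std_simplex V = {t \<in> real_space V. (\<forall>v\<in>V. 0 \<le> t v) \<and> (\<Sum>v\<in>V. t v) = 1}"

text \<open>
  The set \<open>\<S>\<^sub>d(V)\<close>.  The condition \<open>#V - #T = d\<close> is written additively because subtraction on
  natural numbers truncates.
\<close>

definition disjoint_supp_sets :: "nat \<Rightarrow> 'v set \<Rightarrow> ('v \<Rightarrow> real) set set" where
  "disjoint_supp_sets d V =
     {T. finite T \<and> T \<subseteq> std_simplex V \<and> pairwise (\<lambda>s t. disjnt (supp s) (supp t)) T \<and>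
         card V = card T + d}"

text \<open>
  Since covers are sets of sets, the members of the refinement containing a point are counted
  without repetition.
\<close>

definition covering_dim_less :: "'z topology \<Rightarrow> nat \<Rightarrow> bool" where
  "covering_dim_less Z n \<longleftrightarrow>
     (\<forall>\<U>. (\<forall>U\<in>\<U>. openin Z U) \<and> \<Union>\<U> = topspace Z \<longrightarrow>
        (\<exists>\<W>. finite \<W> \<and> (\<forall>W\<in>\<W>. openin Z W) \<and> \<Union>\<W> = topspace Z \<and>
             (\<forall>W\<in>\<W>. \<exists>U\<in>\<U>. W \<subseteq> U) \<and>
             (\<forall>x\<in>topspace Z. card {W \<in> \<W>. x \<in> W} \<le> n)))"

end

theory Submission
  imports Defs "HOL-Library.Z2"
begin

text \<open>
  Suppose that every one of the \<open>m\<close> intersections is empty. Then each \<open>z \<in> Z\<close> lies, for every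
  \<open>l\<close>, outside the compact image belonging to some \<open>T\<close>, and the dimension hypothesis yields a
  finite open cover \<open>\<W>\<close> of \<open>Z\<close>, with at most \<open>n = n\<^sub>1 + \<dots> + n\<^sub>m\<close> members through each point,
  such that every \<open>W \<in> \<W>\<close> misses for each \<open>l\<close> the image belonging to one set \<open>\<tau> W l \<in> \<S>\<close>.

  The elements of \<open>T\<close> are nonnegative and have disjoint supports, so a signed vector \<open>x\<close> of
  \<open>\<ell>\<^sup>1\<close>-norm 1 in the span of \<open>T\<close> has \<open>\<bar>x\<bar> \<in> \<Delta>\<^sub>T\<close>. As the span has codimension \<open>d\<^sub>l\<close>, it is the
  zero set of \<open>d\<^sub>l\<close> linear forms (\<open>hull_equations\<close>). This suggests replacing \<open>\<Delta>(V\<^sub>l)\<close> by the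
  boundary of the cross-polytope in \<open>\<real>[V\<^sub>l]\<close>, a sphere of dimension \<open>d\<^sub>l n\<^sub>l\<close> that maps onto it
  by \<open>x \<mapsto> \<bar>x\<bar>\<close>, since linear forms are odd while everything pulled back from \<open>Z\<close> is even.

  Colour a point by the number \<open>k \<in> {1..n}\<close> of members of \<open>\<W>\<close> through its image, and distribute
  the \<open>n\<close> colours over the factors, \<open>n\<^sub>l\<close> of them to factor \<open>l\<close>. For a colour \<open>k\<close> given to
  factor \<open>l\<close> and \<open>i < d\<^sub>l\<close> consider \<open>h\<^sub>k\<^sub>,\<^sub>i(x) = \<Sum>\<^sub>\<sigma> (\<Prod>\<^sub>W\<^sub>\<in>\<^sub>\<sigma> \<phi>\<^sub>W(\<bar>x\<bar>)) \<lambda>\<^sub>\<sigma>\<^sub>,\<^sub>i(x\<^sub>l)\<close>, where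
  \<open>\<sigma>\<close> runs over the \<open>k\<close>-element subsets of \<open>\<W>\<close>, \<open>\<phi>\<^sub>W\<close> is nonzero exactly over \<open>W\<close>, and the
  \<open>\<lambda>\<^sub>\<sigma>\<^sub>,\<^sub>i\<close> are the forms for \<open>\<tau> W l\<close> with some \<open>W \<in> \<sigma>\<close>. At a point of colour \<open>k\<close> just one
  summand survives, and it cannot vanish for all \<open>i\<close>, because \<open>x\<^sub>l\<close> would then lie in the span
  of \<open>\<tau> W l\<close>, and the image of the point both in \<open>W\<close> and in the image that \<open>W\<close> misses. So the
  \<open>h\<^sub>k\<^sub>,\<^sub>i\<close> have no common zero. But there are \<open>d\<^sub>l n\<^sub>l\<close> of them for factor \<open>l\<close>, each odd in the
  \<open>l\<close>-th sphere variable and even in the others, which contradicts the Borsuk-Ulam theorem for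
  products of spheres, \<open>borsuk_ulam_sphere_prod\<close>.

  That theorem is the nonvanishing of \<open>\<Prod>\<^sub>l w\<^sub>l\<^bsup>N\<^sub>l\<^esup>\<close> in the mod 2 cohomology of
  \<open>\<real>P\<^bsup>N\<^sub>1\<^esup> \<times> \<dots> \<times> \<real>P\<^bsup>N\<^sub>m\<^esup>\<close>, \<open>w\<^sub>l\<close> being the degree one generator for factor \<open>l\<close>, and is proved
  here with explicit cochains. The sign of a function that is odd in factor \<open>l\<close> is a 0-cochain
  \<open>f\<close> whose coboundary is invariant and represents \<open>w\<^sub>l\<close>. The cup product of the coboundaries of
  all the signs evaluates to 1 on a fundamental chain, however finely subdivided (\<open>cell_cup\<close>).
  Hence arbitrarily small simplices exist on which every one of the functions changes sign, and
  a limit point of such simplices is a common zero.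
\<close>

section \<open>Mod 2 cochains on ordered simplices\<close>

(* As simplification rules these would turn sums and products into XOR and AND, which hides
   distributivity and the cancellation of equal summands from the simplifier. *)
declare add_bit_eq_xor [simp del] mult_bit_eq_and [simp del]

lemma bit_add_self [simp]: "x + x = (0::bit)"
  by (cases x) simp_all

lemma bit_add_self_left [simp]: "x + (x + y) = (y::bit)"
  by (simp flip: add.assoc)

lemma bit_add_eq_0D: "x = y" if "x + y = (0::bit)"
  using that by (cases x; cases y) simp_all

text \<open>
  An ordered simplex is the list of its vertices, and a cochain is a function from lists to the
  field with two elements. The recursion unfolds the sum of the values of the cochain on all
  faces. The empty simplex is a face of a vertex, so this is the augmented complex. Chains never
  occur as objects: a chain is represented by the functional that evaluates cochains on it, and
  an operation on chains by the adjoint operation on cochains.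
\<close>

primrec coboundary :: "('a list \<Rightarrow> bit) \<Rightarrow> 'a list \<Rightarrow> bit" where
  "coboundary \<phi> [] = 0"
| "coboundary \<phi> (v # vs) = \<phi> vs + coboundary (\<lambda>ws. \<phi> (v # ws)) vs"

lemma coboundary_add:
  "coboundary (\<lambda>ws. \<phi> ws + \<psi> ws) vs = coboundary \<phi> vs + coboundary \<psi> vs"
  by (induction vs arbitrary: \<phi> \<psi>) (simp_all add: add_ac)

text \<open>
  Deleting two vertices in either order gives the same face, and mod 2 the two contributions
  cancel.
\<close>

lemma coboundary_coboundary: "coboundary (coboundary \<phi>) vs = 0"
  by (induction vs arbitrary: \<phi>) (simp_all add: coboundary_add)

lemma coboundary_map: "coboundary \<phi> (map f vs) = coboundary (\<lambda>ws. \<phi> (map f ws)) vs"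
  by (induction vs arbitrary: \<phi>) simp_all

text \<open>
  This and its analogues for subdivisions and cells trace a nonzero value of a functional back
  to a simplex in the support of the underlying chain. They serve twice: to find small
  simplices, and, applied to the sum of two cochains, to show that a functional depends only on
  the values on that support.
\<close>

lemma coboundary_nonzeroE:
  assumes "coboundary \<phi> vs \<noteq> 0"
  obtains ws where "\<phi> ws \<noteq> 0" "Suc (length ws) = length vs" "set ws \<subseteq> set vs"
proof -
  have "\<exists>ws. \<phi> ws \<noteq> 0 \<and> Suc (length ws) = length vs \<and> set ws \<subseteq> set vs"
    using assms
  proof (induction vs arbitrary: \<phi>)
    case Nil
    then show ?case by simp
  next
    case (Cons v vs)
    then consider "\<phi> vs \<noteq> 0" | "coboundary (\<lambda>ws. \<phi> (v # ws)) vs \<noteq> 0"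
      by (cases "\<phi> vs") auto
    then show ?case
    proof cases
      case 1
      then show ?thesis by (intro exI[of _ vs]) auto
    next
      case 2
      from Cons.IH[OF this] obtain ws where
        "\<phi> (v # ws) \<noteq> 0" "Suc (length ws) = length vs" "set ws \<subseteq> set vs" by blast
      then show ?thesis by (intro exI[of _ "v # ws"]) auto
    qed
  qed
  then show thesis using that by blast
qed

lemma coboundary_cong:
  assumes "\<And>ws. Suc (length ws) = length vs \<Longrightarrow> set ws \<subseteq> set vs \<Longrightarrow> \<phi> ws = \<psi> ws"
  shows "coboundary \<phi> vs = coboundary \<psi> vs"
proof -
  have "coboundary (\<lambda>ws. \<phi> ws + \<psi> ws) vs = 0"
  proof (rule ccontr)
    assume "coboundary (\<lambda>ws. \<phi> ws + \<psi> ws) vs \<noteq> 0"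
    then obtain ws where "\<phi> ws + \<psi> ws \<noteq> 0" "Suc (length ws) = length vs" "set ws \<subseteq> set vs"
      by (rule coboundary_nonzeroE)
    with assms[of ws] show False by simp
  qed
  then show ?thesis
    unfolding coboundary_add by (rule bit_add_eq_0D)
qed

section \<open>Barycentric subdivision\<close>

text \<open>
  The first index of a point names a factor of the product, the second a coordinate in that
  factor.
\<close>

type_synonym point = "nat \<Rightarrow> nat \<Rightarrow> real"

definition barycentre :: "point list \<Rightarrow> point" where
  "barycentre vs = (\<lambda>l i. (\<Sum>v\<leftarrow>vs. v l i) / real (length vs))"

text \<open>
  The subdivision of a simplex is the cone, with apex the barycentre, over the subdivision of
  its boundary. The numerical argument is the number of vertices and only serves the recursion.
\<close>

primrec subdivide_dim :: "nat \<Rightarrow> (point list \<Rightarrow> bit) \<Rightarrow> point list \<Rightarrow> bit" where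
  "subdivide_dim 0 \<phi> vs = \<phi> vs"
| "subdivide_dim (Suc n) \<phi> vs =
     coboundary (subdivide_dim n (\<lambda>ws. \<phi> (barycentre vs # ws))) vs"

definition subdivide :: "(point list \<Rightarrow> bit) \<Rightarrow> point list \<Rightarrow> bit" where
  "subdivide \<phi> vs = subdivide_dim (length vs) \<phi> vs"

lemma subdivide_dim_add:
  "subdivide_dim n (\<lambda>ws. \<phi> ws + \<psi> ws) vs = subdivide_dim n \<phi> vs + subdivide_dim n \<psi> vs"
proof (induction n arbitrary: \<phi> \<psi> vs)
  case (Suc n)
  have "subdivide_dim n (\<lambda>ws. \<phi> (barycentre vs # ws) + \<psi> (barycentre vs # ws)) =
      (\<lambda>ws. subdivide_dim n (\<lambda>ws. \<phi> (barycentre vs # ws)) ws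
         + subdivide_dim n (\<lambda>ws. \<psi> (barycentre vs # ws)) ws)"
    by (rule ext) (rule Suc.IH)
  then show ?case by (simp add: coboundary_add)
qed simp

lemma subdivide_add:
  "subdivide (\<lambda>ws. \<phi> ws + \<psi> ws) vs = subdivide \<phi> vs + subdivide \<psi> vs"
  by (simp add: subdivide_def subdivide_dim_add)

text \<open>
  Subdivision is a chain map. With \<open>C\<close> the cone construction, the recursion
  \<open>Sd \<sigma> = C (Sd (\<partial> \<sigma>))\<close> and \<open>\<partial> (C c) = c + C (\<partial> c)\<close> give
  \<open>\<partial> (Sd \<sigma>) = Sd (\<partial> \<sigma>) + C (\<partial> (Sd (\<partial> \<sigma>)))\<close>, and by induction the second term is
  \<open>C (Sd (\<partial> (\<partial> \<sigma>))) = 0\<close>.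
\<close>

lemma subdivide_coboundary: "subdivide (coboundary \<phi>) vs = coboundary (subdivide \<phi>) vs"
proof (induction "length vs" arbitrary: \<phi> vs)
  case 0
  then show ?case by (simp add: subdivide_def)
next
  case (Suc n)
  let ?b = "barycentre vs"
  let ?\<chi> = "\<lambda>ws. \<phi> (?b # ws)"
  have "subdivide (coboundary \<phi>) vs
      = coboundary (subdivide_dim n (\<lambda>ws. \<phi> ws + coboundary ?\<chi> ws)) vs"
    by (simp add: subdivide_def flip: Suc.hyps(2))
  also have "\<dots> = coboundary (\<lambda>ws. subdivide \<phi> ws + coboundary (subdivide ?\<chi>) ws) vs"
  proof (rule coboundary_cong)
    fix ws :: "point list" assume "Suc (length ws) = length vs"
    then have n: "n = length ws" using Suc.hyps(2) by simp
    show "subdivide_dim n (\<lambda>ws. \<phi> ws + coboundary ?\<chi> ws) ws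
        = subdivide \<phi> ws + coboundary (subdivide ?\<chi>) ws"
      using Suc.hyps(1)[OF n, of ?\<chi>] n by (simp add: subdivide_dim_add subdivide_def)
  qed
  also have "\<dots> = coboundary (subdivide \<phi>) vs"
    by (simp add: coboundary_add coboundary_coboundary)
  finally show ?case .
qed

lemma barycentre_in_convex:
  assumes "convex C" "set vs \<subseteq> C" "vs \<noteq> []"
  shows "barycentre vs \<in> C"
  using assms(3,2)
proof (induction vs rule: list_nonempty_induct)
  case (single x)
  then show ?case by (simp add: barycentre_def)
next
  case (cons x xs)
  let ?n = "real (length xs)"
  have n: "?n > 0" using cons.hyps by simp
  have "barycentre (x # xs) = (1 / (?n + 1)) *\<^sub>R x + (?n / (?n + 1)) *\<^sub>R barycentre xs"
  proof (intro ext)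
    fix l i
    have "?n * (t / ?n) = t" for t using n by simp
    then show "barycentre (x # xs) l i
        = ((1 / (?n + 1)) *\<^sub>R x + (?n / (?n + 1)) *\<^sub>R barycentre xs) l i"
      using n by (simp add: barycentre_def scaleR_fun_def add_divide_distrib add.commute)
  qed
  moreover have "1 / (?n + 1) + ?n / (?n + 1) = 1" using n by (simp add: field_simps)
  moreover have "x \<in> C" "barycentre xs \<in> C" using cons by auto
  ultimately show ?case
    using convexD[OF assms(1), of x "barycentre xs" "1 / (?n + 1)" "?n / (?n + 1)"] n
    by (metis divide_nonneg_pos add_nonneg_pos less_imp_le zero_le_one zero_less_one)
qed

text \<open>
  Size is measured one coordinate at a time, so that no norm on the space of points is needed.
\<close>

definition spread_le :: "real \<Rightarrow> point list \<Rightarrow> bool" where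
  "spread_le \<rho> vs \<longleftrightarrow> (\<forall>u\<in>set vs. \<forall>v\<in>set vs. \<forall>l i. \<bar>u l i - v l i\<bar> \<le> \<rho>)"

lemma convex_box: "convex {w :: point. \<forall>l i. \<bar>b l i - w l i\<bar> \<le> c}"
proof (rule convexI, unfold mem_Collect_eq, intro allI)
  fix x y :: point and u v :: real and l i
  assume h: "\<forall>l i. \<bar>b l i - x l i\<bar> \<le> c" "\<forall>l i. \<bar>b l i - y l i\<bar> \<le> c" "0 \<le> u" "0 \<le> v" "u + v = 1"
  have "b l i - (u * x l i + v * y l i) = u * (b l i - x l i) + v * (b l i - y l i)"
  proof -
    have "b l i = (u + v) * b l i" using h(5) by simp
    then show ?thesis by (simp add: algebra_simps)
  qed
  also have "\<bar>\<dots>\<bar> \<le> u * \<bar>b l i - x l i\<bar> + v * \<bar>b l i - y l i\<bar>"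
    using h(3,4) by (metis abs_mult abs_of_nonneg abs_triangle_ineq)
  also have "\<dots> \<le> u * c + v * c"
    using h by (intro add_mono mult_left_mono) auto
  also have "\<dots> = c" using h(5) by (metis distrib_right mult_1)
  finally show "\<bar>b l i - (u *\<^sub>R x + v *\<^sub>R y) l i\<bar> \<le> c" by (simp add: scaleR_fun_def)
qed

text \<open>
  In the average of the differences \<open>w - v\<close> over all vertices \<open>w\<close>, the term with \<open>w = v\<close> is
  zero.
\<close>

lemma barycentre_spread:
  assumes "spread_le \<rho> vs" "v \<in> set vs" "\<rho> \<ge> 0"
  shows "\<bar>barycentre vs l i - v l i\<bar> \<le> (1 - 1 / real (length vs)) * \<rho>"
proof -
  let ?n = "real (length vs)"
  have n: "?n > 0" using assms(2) by (cases vs) auto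
  obtain xs ys where vs: "vs = xs @ v # ys" using assms(2) by (meson split_list)
  have *: "\<bar>\<Sum>w\<leftarrow>zs. w l i - v l i\<bar> \<le> real (length zs) * \<rho>" if "set zs \<subseteq> set vs" for zs
    using that
  proof (induction zs)
    case (Cons z zs)
    have "\<bar>z l i - v l i\<bar> \<le> \<rho>" using Cons.prems assms(1,2) by (auto simp: spread_le_def)
    moreover have "\<bar>\<Sum>w\<leftarrow>zs. w l i - v l i\<bar> \<le> real (length zs) * \<rho>"
      using Cons by simp
    ultimately have "\<bar>z l i - v l i + (\<Sum>w\<leftarrow>zs. w l i - v l i)\<bar> \<le> \<rho> + real (length zs) * \<rho>"
      by linarith
    then show ?case by (simp add: algebra_simps)
  qed simp
  have sub: "(\<Sum>w\<leftarrow>zs. w l i - v l i) = (\<Sum>w\<leftarrow>zs. w l i) - real (length zs) * v l i" for zs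
    by (induction zs) (simp_all add: algebra_simps)
  have "barycentre vs l i - v l i = (\<Sum>w\<leftarrow>xs @ ys. w l i - v l i) / ?n"
    unfolding sub using n by (simp add: barycentre_def vs field_simps)
  then have "\<bar>barycentre vs l i - v l i\<bar> = \<bar>\<Sum>w\<leftarrow>xs @ ys. w l i - v l i\<bar> / ?n"
    using n by simp
  also have "\<dots> \<le> real (length (xs @ ys)) * \<rho> / ?n"
    using n by (intro divide_right_mono *) (auto simp: vs)
  also have "\<dots> = (1 - 1 / ?n) * \<rho>"
    using n by (simp add: vs field_simps)
  finally show ?thesis .
qed

text \<open>
  A simplex of the subdivision is the barycentre followed by a simplex of a subdivided face. The
  latter has shrunk by an even better factor and stays in the box around the barycentre given by
  the preceding lemma; carrying an arbitrary convex set \<open>C\<close> through the induction keeps track of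
  that box.
\<close>

lemma subdivide_dim_nonzeroD:
  assumes "subdivide_dim n \<phi> vs \<noteq> 0" "length vs = n" "convex C" "set vs \<subseteq> C"
    and "spread_le \<rho> vs" "\<rho> \<ge> 0"
  shows "\<exists>ws. \<phi> ws \<noteq> 0 \<and> length ws = n \<and> set ws \<subseteq> C \<and> spread_le ((1 - 1 / real n) * \<rho>) ws"
  using assms(1-5)
proof (induction n arbitrary: \<phi> vs C)
  case 0
  then show ?case by (intro exI[of _ vs]) (auto simp: spread_le_def)
next
  case (Suc n)
  let ?b = "barycentre vs" and ?c = "(1 - 1 / real (Suc n)) * \<rho>"
  define B where "B = {w :: point. \<forall>l i. \<bar>?b l i - w l i\<bar> \<le> ?c}"
  have c: "?c \<ge> 0" using assms(6) by (intro mult_nonneg_nonneg) (auto simp: field_simps)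
  have B: "set vs \<subseteq> B"
    using barycentre_spread[OF Suc.prems(5) _ assms(6)] Suc.prems(2) by (auto simp: B_def)
  from Suc.prems(1) obtain f where f:
    "subdivide_dim n (\<lambda>ws. \<phi> (?b # ws)) f \<noteq> 0" "Suc (length f) = length vs" "set f \<subseteq> set vs"
    unfolding subdivide_dim.simps by (rule coboundary_nonzeroE)
  have "\<exists>ws. \<phi> (?b # ws) \<noteq> 0 \<and> length ws = n \<and> set ws \<subseteq> C \<inter> B \<and> spread_le ((1 - 1 / real n) * \<rho>) ws"
  proof (rule Suc.IH[OF f(1)])
    show "length f = n" using f(2) Suc.prems(2) by simp
    show "convex (C \<inter> B)" unfolding B_def by (intro convex_Int Suc.prems(3) convex_box)
    show "set f \<subseteq> C \<inter> B" using f(3) B Suc.prems(4) by blast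
    show "spread_le \<rho> f" using f(3) Suc.prems(5) unfolding spread_le_def by blast
  qed
  then obtain ws where ws: "\<phi> (?b # ws) \<noteq> 0" "length ws = n" "set ws \<subseteq> C \<inter> B"
    "spread_le ((1 - 1 / real n) * \<rho>) ws" by blast
  have bC: "?b \<in> C" using Suc.prems by (intro barycentre_in_convex) auto
  have "spread_le ?c ws"
  proof (cases "n = 0")
    case True then show ?thesis using ws(2) by (simp add: spread_le_def)
  next
    case False
    then have "(1 - 1 / real n) * \<rho> \<le> ?c"
      using assms(6) by (intro mult_right_mono) (auto simp: field_simps)
    then show ?thesis using ws(4) unfolding spread_le_def by (meson order_trans)
  qed
  moreover have "\<bar>?b l i - w l i\<bar> \<le> ?c" if "w \<in> set ws" for w l i
    using that ws(3) by (auto simp: B_def)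
  ultimately have "spread_le ?c (?b # ws)"
    using c unfolding spread_le_def by (simp add: abs_minus_commute)
  then show ?case using ws bC by (intro exI[of _ "?b # ws"]) auto
qed

lemma iterated_subdivide_nonzeroD:
  assumes "(subdivide ^^ r) \<phi> vs \<noteq> 0" "length vs = n" "convex C" "set vs \<subseteq> C"
    and "spread_le \<rho> vs" "\<rho> \<ge> 0"
  shows "\<exists>ws. \<phi> ws \<noteq> 0 \<and> length ws = n \<and> set ws \<subseteq> C \<and> spread_le ((1 - 1 / real n) ^ r * \<rho>) ws"
  using assms(1,2,4,5,6)
proof (induction r arbitrary: vs \<rho>)
  case 0
  then show ?case by auto
next
  case (Suc r)
  have "subdivide_dim n ((subdivide ^^ r) \<phi>) vs \<noteq> 0"
    using Suc.prems(1) unfolding funpow.simps comp_apply subdivide_def[of _ vs] Suc.prems(2) .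
  from subdivide_dim_nonzeroD[OF this Suc.prems(2) assms(3) Suc.prems(3-5)]
  obtain us where us: "(subdivide ^^ r) \<phi> us \<noteq> 0" "length us = n" "set us \<subseteq> C"
    "spread_le ((1 - 1 / real n) * \<rho>) us" by blast
  have "(1 - 1 / real n) * \<rho> \<ge> 0"
    using Suc.prems(5) by (cases n) (auto intro!: mult_nonneg_nonneg simp: field_simps)
  from Suc.IH[OF us this] show ?case by (simp add: mult.assoc mult.left_commute)
qed

lemma iterated_subdivide_add:
  "(subdivide ^^ r) (\<lambda>ws. \<phi> ws + \<psi> ws) vs = (subdivide ^^ r) \<phi> vs + (subdivide ^^ r) \<psi> vs"
proof (induction r arbitrary: vs)
  case (Suc r)
  then have "(subdivide ^^ r) (\<lambda>ws. \<phi> ws + \<psi> ws)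
      = (\<lambda>ws. (subdivide ^^ r) \<phi> ws + (subdivide ^^ r) \<psi> ws)" by blast
  then show ?case by (simp add: subdivide_add)
qed simp

lemma iterated_subdivide_coboundary:
  "(subdivide ^^ r) (coboundary \<phi>) = coboundary ((subdivide ^^ r) \<phi>)"
proof (induction r)
  case (Suc r)
  have "subdivide (coboundary \<psi>) = coboundary (subdivide \<psi>)" for \<psi>
    by (rule ext) (rule subdivide_coboundary)
  then show ?case by (simp add: Suc.IH)
qed simp

lemma iterated_subdivide_cong:
  assumes "convex C" "set vs \<subseteq> C" "spread_le \<rho> vs" "\<rho> \<ge> 0"
    and eq: "\<And>ws. length ws = length vs \<Longrightarrow> set ws \<subseteq> C \<Longrightarrow> \<phi> ws = \<psi> ws"
  shows "(subdivide ^^ r) \<phi> vs = (subdivide ^^ r) \<psi> vs"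
proof -
  have "(subdivide ^^ r) (\<lambda>ws. \<phi> ws + \<psi> ws) vs = 0"
  proof (rule ccontr)
    assume "(subdivide ^^ r) (\<lambda>ws. \<phi> ws + \<psi> ws) vs \<noteq> 0"
    from iterated_subdivide_nonzeroD[OF this refl assms(1-4)] eq show False by fastforce
  qed
  then show ?thesis
    unfolding iterated_subdivide_add by (rule bit_add_eq_0D)
qed

section \<open>Fundamental chains of products of spheres\<close>

lemma sum_bit_symmetric_eq_0:
  fixes Q :: "nat \<times> nat \<Rightarrow> bit"
  assumes "finite S"
    and sym: "\<And>l j. (l, j) \<in> S \<Longrightarrow> l \<noteq> j \<Longrightarrow> (j, l) \<in> S \<and> Q (l, j) = Q (j, l)"
    and diag: "\<And>l. Q (l, l) = 0"
  shows "sum Q S = 0"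
proof -
  define L where "L = {p \<in> S. fst p < snd p}"
  define G where "G = {p \<in> S. snd p < fst p}"
  have fin: "finite L" "finite G" using assms(1) by (simp_all add: L_def G_def)
  have "sum Q S = sum Q (L \<union> G)"
  proof (rule sum.mono_neutral_right[OF assms(1)])
    show "\<forall>p\<in>S - (L \<union> G). Q p = 0"
    proof
      fix p assume "p \<in> S - (L \<union> G)"
      then have "fst p = snd p" by (auto simp: L_def G_def)
      then show "Q p = 0" by (metis diag prod.collapse)
    qed
  qed (auto simp: L_def G_def)
  also have "\<dots> = sum Q L + sum Q G"
    by (rule sum.union_disjoint[OF fin]) (auto simp: L_def G_def)
  also have "sum Q G = sum Q L"
    by (rule sum.reindex_bij_witness[of _ prod.swap prod.swap])
      (use sym in \<open>auto simp: L_def G_def\<close>)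
  finally show ?thesis by simp
qed

text \<open>
  The antipodal map of a single factor; the flips generate the group acting on the product.
\<close>

definition flip :: "nat \<Rightarrow> point \<Rightarrow> point" where
  "flip l x = x(l := (\<lambda>i. - x l i))"

lemma flip_flip [simp]: "flip l (flip l x) = x"
  by (auto simp: flip_def fun_eq_iff)

lemma flip_commute: "flip l (flip j x) = flip j (flip l x)"
  by (auto simp: flip_def fun_eq_iff)

lemma barycentre_flip: "vs \<noteq> [] \<Longrightarrow> barycentre (map (flip l) vs) = flip l (barycentre vs)"
proof (intro ext)
  fix j i
  have "(\<Sum>v\<leftarrow>vs. flip l v j i) = (if j = l then - (\<Sum>v\<leftarrow>vs. v j i) else (\<Sum>v\<leftarrow>vs. v j i))"
    by (induction vs) (auto simp: flip_def)
  then show "barycentre (map (flip l) vs) j i = flip l (barycentre vs) j i"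
    by (simp add: barycentre_def flip_def comp_def)
qed

lemma subdivide_dim_flip:
  "length vs = n \<Longrightarrow> subdivide_dim n \<phi> (map (flip l) vs) = subdivide_dim n (\<lambda>ws. \<phi> (map (flip l) ws)) vs"
proof (induction n arbitrary: \<phi> vs)
  case (Suc n)
  then have b: "barycentre (map (flip l) vs) = flip l (barycentre vs)"
    by (intro barycentre_flip) auto
  show ?case
    unfolding subdivide_dim.simps coboundary_map b
    by (rule coboundary_cong) (use Suc in \<open>simp add: Suc.IH\<close>)
qed simp

lemma iterated_subdivide_flip:
  "(subdivide ^^ r) \<phi> (map (flip l) vs) = (subdivide ^^ r) (\<lambda>ws. \<phi> (map (flip l) ws)) vs"
proof (induction r arbitrary: vs)
  case (Suc r)
  have "(\<lambda>ws. (subdivide ^^ r) \<phi> (map (flip l) ws)) = (subdivide ^^ r) (\<lambda>ws. \<phi> (map (flip l) ws))"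
    by (rule ext) (rule Suc.IH)
  then show ?case
    unfolding funpow.simps comp_apply subdivide_def[of _ "map (flip l) vs"] subdivide_def[of _ vs]
      length_map subdivide_dim_flip[OF refl] by simp
qed simp

lemma iterated_subdivide_singleton: "(subdivide ^^ r) \<phi> [v] = \<phi> [v]"
proof (induction r)
  case (Suc r)
  have "barycentre [v] = v" by (simp add: barycentre_def)
  then show ?case using Suc by (simp add: subdivide_def)
qed simp

text \<open>
  The pole of the product of closed hemispheres of dimensions \<open>a j\<close>.
\<close>

definition apex :: "nat set \<Rightarrow> (nat \<Rightarrow> nat) \<Rightarrow> point" where
  "apex I a = (\<lambda>j i. if j \<in> I \<and> i = a j then 1 else 0)"

text \<open>
  The cells of the usual antipodal cell structure on a product of spheres: \<open>cell I k a\<close> is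
  evaluation on a triangulated product of closed hemispheres, of dimension \<open>a j\<close> in factor \<open>j\<close>
  and of total dimension \<open>k\<close>. Its boundary should be \<open>\<Sum>\<^sub>l (1 + flip\<^sub>l) e\<^sub>l\<close>, with \<open>e\<^sub>l\<close> the cell
  whose dimension in factor \<open>l\<close> is one less, and the cell is defined as the cone over this chain
  with apex the product of the poles.
\<close>

primrec cell :: "nat set \<Rightarrow> nat \<Rightarrow> (nat \<Rightarrow> nat) \<Rightarrow> (point list \<Rightarrow> bit) \<Rightarrow> bit" where
  "cell I 0 a \<phi> = \<phi> [apex I a]"
| "cell I (Suc k) a \<phi> = (\<Sum>l\<in>{l\<in>I. a l > 0}.
     cell I k (a(l := a l - 1)) (\<lambda>ws. \<phi> (apex I a # ws)) +
     cell I k (a(l := a l - 1)) (\<lambda>ws. \<phi> (apex I a # map (flip l) ws)))"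

lemma cell_add: "cell I k a (\<lambda>ws. \<phi> ws + \<psi> ws) = cell I k a \<phi> + cell I k a \<psi>"
proof (induction k arbitrary: a \<phi> \<psi>)
  case (Suc k)
  show ?case
    unfolding cell.simps Suc.IH sum.distrib by (simp only: add_ac)
qed simp

text \<open>
  The cone over a chain \<open>c\<close> has boundary \<open>c\<close> if \<open>c\<close> is a cycle. The chain \<open>\<Sum>\<^sub>l (1 + flip\<^sub>l) e\<^sub>l\<close>
  is one: its boundary is the sum of \<open>(1 + flip\<^sub>l) (1 + flip\<^sub>j) e\<^sub>l\<^sub>j\<close>, in which the terms for
  \<open>(l, j)\<close> and \<open>(j, l)\<close> cancel and those for \<open>l = j\<close> are zero, as a flip is an involution.
\<close>

lemma cell_coboundary:
  assumes "finite I" "sum a I = Suc k"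
  shows "cell I (Suc k) a (coboundary \<phi>) = (\<Sum>l\<in>{l\<in>I. a l > 0}.
     cell I k (a(l := a l - 1)) \<phi> + cell I k (a(l := a l - 1)) (\<lambda>ws. \<phi> (map (flip l) ws)))"
  using assms(2)
proof (induction k arbitrary: a \<phi>)
  case 0
  have "(x + (z + 0)) + (y + (z + 0)) = x + y" for x y z :: bit
    by (cases x; cases y; cases z) simp_all
  then show ?case by (simp only: cell.simps coboundary.simps list.map)
next
  case (Suc k)
  define \<eta> where "\<eta> = (\<lambda>ws. \<phi> (apex I a # ws))"
  define A where "A = {l \<in> I. a l > 0}"
  define dn where "dn b l = b(l := b l - 1)" for b :: "nat \<Rightarrow> nat" and l :: nat
  define B where "B l = {j \<in> I. dn a l j > 0}" for l
  define Q where "Q = (\<lambda>(l, j).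
     cell I k (dn (dn a l) j) \<eta> + cell I k (dn (dn a l) j) (\<lambda>ws. \<eta> (map (flip j) ws)) +
     (cell I k (dn (dn a l) j) (\<lambda>ws. \<eta> (map (flip l) ws)) +
      cell I k (dn (dn a l) j) (\<lambda>ws. \<eta> (map (flip l) (map (flip j) ws)))))"
  have fin: "finite A" "\<And>l. finite (B l)" using assms(1) by (simp_all add: A_def B_def)
  \<comment> \<open>The base of the cone is a cycle; \<open>B l\<close> and \<open>Q (l, j)\<close> describe its twofold boundary.\<close>
  have cyc: "(\<Sum>l\<in>A. cell I (Suc k) (dn a l) (coboundary \<eta>) +
       cell I (Suc k) (dn a l) (coboundary (\<lambda>ws. \<eta> (map (flip l) ws)))) = 0"
  proof -
    have "cell I (Suc k) (dn a l) (coboundary \<eta>) +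
        cell I (Suc k) (dn a l) (coboundary (\<lambda>ws. \<eta> (map (flip l) ws))) = (\<Sum>j\<in>B l. Q (l, j))"
      if "l \<in> A" for l
    proof -
      have "sum a I = a l + sum a (I - {l})"
        using that assms(1) by (intro sum.remove) (auto simp: A_def)
      moreover have "sum (dn a l) I = dn a l l + sum (dn a l) (I - {l})"
        using that assms(1) by (intro sum.remove) (auto simp: A_def)
      moreover have "sum (dn a l) (I - {l}) = sum a (I - {l})"
        by (rule sum.cong) (auto simp: dn_def)
      moreover have "dn a l l = a l - 1" "a l > 0" using that by (simp_all add: A_def dn_def)
      ultimately have s: "sum (dn a l) I = Suc k"
        using Suc.prems by linarith
      show ?thesis
        unfolding Suc.IH[OF s] B_def[symmetric] dn_def[symmetric] Q_def split_conv
        by (rule sum.distrib[symmetric])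
    qed
    then have "(\<Sum>l\<in>A. cell I (Suc k) (dn a l) (coboundary \<eta>) +
       cell I (Suc k) (dn a l) (coboundary (\<lambda>ws. \<eta> (map (flip l) ws)))) = (\<Sum>l\<in>A. \<Sum>j\<in>B l. Q (l, j))"
      by (rule sum.cong[OF refl])
    also have "\<dots> = sum Q (Sigma A B)"
      by (subst sum.Sigma) (use fin in auto)
    also have "\<dots> = 0"
    proof (rule sum_bit_symmetric_eq_0)
      show "finite (Sigma A B)" using fin by auto
      show "Q (l, l) = 0" for l
      proof -
        have "map (flip l) (map (flip l) ws) = ws" for ws by (simp add: comp_def)
        moreover have "x + y + (y + x) = 0" for x y :: bit by (cases x; cases y) simp_all
        ultimately show ?thesis unfolding Q_def split_conv by (simp only:)
      qed
      show "(j, l) \<in> Sigma A B \<and> Q (l, j) = Q (j, l)" if "(l, j) \<in> Sigma A B" "l \<noteq> j" for l j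
      proof -
        have dn: "dn (dn a l) j = dn (dn a j) l" using \<open>l \<noteq> j\<close> by (auto simp: dn_def fun_eq_iff)
        have comm: "(\<lambda>ws. \<eta> (map (flip l) (map (flip j) ws))) = (\<lambda>ws. \<eta> (map (flip j) (map (flip l) ws)))"
          by (simp add: comp_def flip_commute)
        have four: "x + y + (z + w) = x + z + (y + w)" for x y z w :: bit
          by (simp only: add_ac)
        have "Q (l, j) = Q (j, l)" unfolding Q_def split_conv dn comm by (rule four)
        then show ?thesis using that by (auto simp: A_def B_def dn_def)
      qed
    qed
    finally show ?thesis .
  qed
  have c1: "coboundary \<phi> (apex I a # ws) = \<phi> ws + coboundary \<eta> ws" for ws
    by (simp add: \<eta>_def)
  have c2: "coboundary \<phi> (apex I a # map (flip l) ws)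
     = \<phi> (map (flip l) ws) + coboundary (\<lambda>ws. \<eta> (map (flip l) ws)) ws" for l ws
    by (simp add: \<eta>_def coboundary_map)
  have "cell I (Suc (Suc k)) a (coboundary \<phi>)
      = (\<Sum>l\<in>A. cell I (Suc k) (dn a l) (\<lambda>ws. \<phi> ws + coboundary \<eta> ws) +
          cell I (Suc k) (dn a l) (\<lambda>ws. \<phi> (map (flip l) ws) + coboundary (\<lambda>ws. \<eta> (map (flip l) ws)) ws))"
    by (subst cell.simps(2)) (simp only: c2, simp only: c1 A_def dn_def)
  also have "\<dots> = (\<Sum>l\<in>A. (cell I (Suc k) (dn a l) \<phi> + cell I (Suc k) (dn a l) (\<lambda>ws. \<phi> (map (flip l) ws))) +
        (cell I (Suc k) (dn a l) (coboundary \<eta>) +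
       cell I (Suc k) (dn a l) (coboundary (\<lambda>ws. \<eta> (map (flip l) ws)))))"
    unfolding cell_add by (rule sum.cong[OF refl]) (simp only: add_ac)
  also have "\<dots> = (\<Sum>l\<in>A. cell I (Suc k) (dn a l) \<phi> + cell I (Suc k) (dn a l) (\<lambda>ws. \<phi> (map (flip l) ws)))"
    by (subst sum.distrib) (simp only: cyc add_0_right)
  finally show ?case by (simp only: A_def dn_def)
qed

text \<open>
  A face of a product of cross-polytopes, cut out by the sign pattern \<open>\<sigma>\<close>.
\<close>

definition facet :: "nat set \<Rightarrow> (nat \<Rightarrow> nat \<Rightarrow> real) \<Rightarrow> (nat \<Rightarrow> nat) \<Rightarrow> point set" where
  "facet I \<sigma> a = {x. (\<forall>j i. if j \<in> I \<and> i \<le> a j then 0 \<le> \<sigma> j i * x j i else x j i = 0) \<and>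
     (\<forall>j\<in>I. (\<Sum>i\<le>a j. \<sigma> j i * x j i) = 1)}"

text \<open>
  Each sphere is the boundary of a cross-polytope, the unit sphere of the \<open>\<ell>\<^sup>1\<close>-norm on
  \<open>a j + 1\<close> coordinates. With this choice simplices with vertices in a common facet stay on the
  sphere.
\<close>

definition sphere_prod :: "nat set \<Rightarrow> (nat \<Rightarrow> nat) \<Rightarrow> point set" where
  "sphere_prod I a = {x. (\<forall>j i. \<not> (j \<in> I \<and> i \<le> a j) \<longrightarrow> x j i = 0) \<and>
     (\<forall>j\<in>I. (\<Sum>i\<le>a j. \<bar>x j i\<bar>) = 1)}"

lemma convex_facet: "convex (facet I \<sigma> a)"
proof (rule convexI)
  fix x y :: point and u v :: real
  assume x: "x \<in> facet I \<sigma> a" and y: "y \<in> facet I \<sigma> a" and uv: "0 \<le> u" "0 \<le> v" "u + v = 1"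
  have eq: "(u *\<^sub>R x + v *\<^sub>R y) j i = u * x j i + v * y j i" for j i
    by (simp add: scaleR_fun_def)
  have eq': "\<sigma> j i * (u * x j i + v * y j i) = u * (\<sigma> j i * x j i) + v * (\<sigma> j i * y j i)" for j i
    by (simp add: algebra_simps)
  show "u *\<^sub>R x + v *\<^sub>R y \<in> facet I \<sigma> a"
    unfolding facet_def mem_Collect_eq eq eq'
    using x y uv
    by (auto simp: facet_def sum.distrib simp flip: sum_distrib_left)
qed

lemma facet_subset_sphere_prod:
  assumes "\<And>j i. \<bar>\<sigma> j i\<bar> = 1"
  shows "facet I \<sigma> a \<subseteq> sphere_prod I a"
proof
  fix x assume x: "x \<in> facet I \<sigma> a"
  have "\<bar>x j i\<bar> = \<sigma> j i * x j i" if "j \<in> I" "i \<le> a j" for j i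
  proof -
    have "0 \<le> \<sigma> j i * x j i" using x that by (auto simp: facet_def)
    then have "\<sigma> j i * x j i = \<bar>\<sigma> j i * x j i\<bar>" by simp
    then show ?thesis by (simp add: abs_mult assms)
  qed
  then show "x \<in> sphere_prod I a"
    using x by (auto simp: facet_def sphere_prod_def)
qed

lemma facet_flip:
  assumes "x \<in> facet I \<sigma> a"
  shows "flip l x \<in> facet I (\<sigma>(l := (\<lambda>i. - \<sigma> l i))) a"
proof -
  have "(\<sigma>(l := (\<lambda>i. - \<sigma> l i))) j i * flip l x j i = \<sigma> j i * x j i" for j i
    by (simp add: flip_def)
  moreover have "flip l x j i = 0 \<longleftrightarrow> x j i = 0" for j i by (simp add: flip_def)
  ultimately show ?thesis using assms by (simp add: facet_def)
qed

lemma facet_raise: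
  assumes x: "x \<in> facet I \<sigma> (a(l := a l - 1))" and l: "l \<in> I" "a l > 0"
  shows "x \<in> facet I (\<sigma>(l := (\<sigma> l)(a l := 1))) a"
proof -
  obtain k where k: "a l = Suc k" using l(2) gr0_implies_Suc by blast
  have z: "x l (Suc k) = 0" using x l k by (auto simp: facet_def split: if_splits dest!: spec[of _ l])
  have c: "if j \<in> I \<and> i \<le> (a(l := a l - 1)) j then 0 \<le> \<sigma> j i * x j i else x j i = 0" for j i
    using x by (auto simp: facet_def)
  have "if j \<in> I \<and> i \<le> a j then 0 \<le> (\<sigma>(l := (\<sigma> l)(a l := 1))) j i * x j i else x j i = 0" for j i
    using c[of j i] z l k by (auto split: if_splits simp: le_Suc_eq)
  moreover have "(\<Sum>i\<le>a j. (\<sigma>(l := (\<sigma> l)(a l := 1))) j i * x j i) = 1" if "j \<in> I" for j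
  proof -
    have s: "(\<Sum>i\<le>(a(l := a l - 1)) j. \<sigma> j i * x j i) = 1" using x that by (auto simp: facet_def)
    show ?thesis
    proof (cases "j = l")
      case True
      have "(\<Sum>i\<le>k. ((\<sigma> l)(Suc k := 1)) i * x l i) = (\<Sum>i\<le>k. \<sigma> l i * x l i)"
        by (rule sum.cong) auto
      then show ?thesis using s True k z by simp
    next
      case False
      then show ?thesis using s by simp
    qed
  qed
  ultimately show ?thesis unfolding facet_def by blast
qed

lemma apex_in_facet:
  assumes "\<And>j. j \<in> I \<Longrightarrow> \<sigma> j (a j) = 1"
  shows "apex I a \<in> facet I \<sigma> a"
proof -
  have "(\<Sum>i\<le>a j. \<sigma> j i * apex I a j i) = 1" if "j \<in> I" for j
  proof -
    have "(\<Sum>i\<le>a j. \<sigma> j i * apex I a j i) = (\<Sum>i\<le>a j. if i = a j then \<sigma> j i else 0)"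
      by (rule sum.cong) (auto simp: apex_def that)
    then show ?thesis using assms that by simp
  qed
  then show ?thesis using assms by (auto simp: facet_def apex_def)
qed

text \<open>
  A simplex of a cell stays in one facet because a flip in factor \<open>l\<close> is always followed by
  raising the dimension of that factor, where the sign of the new coordinate can still be
  chosen. In the induction the sign of the last coordinate of each factor has to be positive,
  because the apex of a later cone may lie on it.
\<close>

lemma cell_nonzeroE:
  assumes "cell I k a \<phi> \<noteq> 0"
  obtains \<sigma> ws where "\<phi> ws \<noteq> 0" "length ws = Suc k" "set ws \<subseteq> facet I \<sigma> a" "\<And>j i. \<bar>\<sigma> j i\<bar> = 1"
proof -
  have "\<exists>\<sigma> ws. \<phi> ws \<noteq> 0 \<and> length ws = Suc k \<and> set ws \<subseteq> facet I \<sigma> a \<and>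
      (\<forall>j i. \<bar>\<sigma> j i\<bar> = 1) \<and> (\<forall>j\<in>I. \<sigma> j (a j) = 1)"
    using assms
  proof (induction k arbitrary: a \<phi>)
    case 0
    show ?case
      by (rule exI[of _ "\<lambda>j i. 1"], rule exI[of _ "[apex I a]"])
        (use 0 apex_in_facet[of I "\<lambda>j i. 1" a] in auto)
  next
    case (Suc k)
    let ?b = "\<lambda>l. a(l := a l - 1)"
    from Suc.prems obtain l where l: "l \<in> I" "a l > 0" and nz:
      "cell I k (?b l) (\<lambda>ws. \<phi> (apex I a # ws)) +
       cell I k (?b l) (\<lambda>ws. \<phi> (apex I a # map (flip l) ws)) \<noteq> 0"
      unfolding cell.simps by (metis (no_types, lifting) mem_Collect_eq sum.neutral)
    have "\<exists>\<tau> us. \<phi> (apex I a # us) \<noteq> 0 \<and> length us = Suc k \<and> set us \<subseteq> facet I \<tau> (?b l) \<and>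
        (\<forall>j i. \<bar>\<tau> j i\<bar> = 1) \<and> (\<forall>j\<in>I - {l}. \<tau> j (a j) = 1)"
    proof (cases "cell I k (?b l) (\<lambda>ws. \<phi> (apex I a # ws)) = 0")
      case False
      from Suc.IH[OF this] obtain \<sigma> ws where *: "\<phi> (apex I a # ws) \<noteq> 0" "length ws = Suc k"
        "set ws \<subseteq> facet I \<sigma> (?b l)" "\<forall>j i. \<bar>\<sigma> j i\<bar> = 1" "\<forall>j\<in>I. \<sigma> j (?b l j) = 1" by blast
      have "\<forall>j\<in>I - {l}. \<sigma> j (a j) = 1" using *(5) by (metis Diff_iff fun_upd_other singletonI)
      then show ?thesis using * by blast
    next
      case True
      with nz have "cell I k (?b l) (\<lambda>ws. \<phi> (apex I a # map (flip l) ws)) \<noteq> 0" by simp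
      from Suc.IH[OF this] obtain \<sigma> ws where *: "\<phi> (apex I a # map (flip l) ws) \<noteq> 0" "length ws = Suc k"
        "set ws \<subseteq> facet I \<sigma> (?b l)" "\<forall>j i. \<bar>\<sigma> j i\<bar> = 1" "\<forall>j\<in>I. \<sigma> j (?b l j) = 1" by blast
      let ?\<tau> = "\<sigma>(l := (\<lambda>i. - \<sigma> l i))"
      have "set (map (flip l) ws) \<subseteq> facet I ?\<tau> (?b l)"
        using *(3) facet_flip[of _ I \<sigma> "?b l" l] by auto
      moreover have "\<forall>j\<in>I - {l}. ?\<tau> j (a j) = 1" using *(5) by (metis Diff_iff fun_upd_other singletonI)
      moreover have "\<forall>j i. \<bar>?\<tau> j i\<bar> = 1" using *(4) by simp
      moreover have "length (map (flip l) ws) = Suc k" using *(2) by simp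
      ultimately show ?thesis using *(1) by blast
    qed
    then obtain \<tau> us where us: "\<phi> (apex I a # us) \<noteq> 0" "length us = Suc k"
      "set us \<subseteq> facet I \<tau> (?b l)" "\<forall>j i. \<bar>\<tau> j i\<bar> = 1" "\<forall>j\<in>I - {l}. \<tau> j (a j) = 1" by blast
    let ?\<sigma> = "\<tau>(l := (\<tau> l)(a l := 1))"
    have "apex I a \<in> facet I ?\<sigma> a" using us(5) by (intro apex_in_facet) auto
    moreover have "set us \<subseteq> facet I ?\<sigma> a" using us(3) facet_raise[of _ I \<tau> a l] l by blast
    ultimately have "set (apex I a # us) \<subseteq> facet I ?\<sigma> a" by simp
    moreover have "\<forall>j i. \<bar>?\<sigma> j i\<bar> = 1" using us(4) by simp
    moreover have "\<forall>j\<in>I. ?\<sigma> j (a j) = 1" using us(5) by simp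
    moreover have "length (apex I a # us) = Suc (Suc k)" using us(2) by simp
    ultimately show ?case using us(1) by blast
  qed
  then show thesis using that by blast
qed

lemma sphere_prod_abs_le_1:
  assumes "x \<in> sphere_prod I a"
  shows "\<bar>x j i\<bar> \<le> 1"
proof (cases "j \<in> I \<and> i \<le> a j")
  case True
  then have "\<bar>x j i\<bar> \<le> (\<Sum>i\<le>a j. \<bar>x j i\<bar>)" by (intro member_le_sum) auto
  then show ?thesis using True assms by (auto simp: sphere_prod_def)
next
  case False
  then show ?thesis using assms by (auto simp: sphere_prod_def)
qed

lemma sphere_prod_spread:
  assumes "set ws \<subseteq> sphere_prod I a"
  shows "spread_le 2 ws"
  unfolding spread_le_def
proof (intro ballI allI)
  fix u v l i assume "u \<in> set ws" "v \<in> set ws"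
  then have "\<bar>u l i\<bar> \<le> 1" "\<bar>v l i\<bar> \<le> 1" using assms sphere_prod_abs_le_1 by blast+
  then show "\<bar>u l i - v l i\<bar> \<le> 2" by linarith
qed

lemma cell_subdivide_cong:
  assumes "\<And>ws. length ws = Suc k \<Longrightarrow> set ws \<subseteq> sphere_prod I a \<Longrightarrow> \<phi> ws = \<psi> ws"
  shows "cell I k a ((subdivide ^^ r) \<phi>) = cell I k a ((subdivide ^^ r) \<psi>)"
proof -
  have "cell I k a (\<lambda>ws. (subdivide ^^ r) \<phi> ws + (subdivide ^^ r) \<psi> ws) = 0"
  proof (rule ccontr)
    assume "cell I k a (\<lambda>ws. (subdivide ^^ r) \<phi> ws + (subdivide ^^ r) \<psi> ws) \<noteq> 0"
    then obtain \<sigma> ws where ws: "(subdivide ^^ r) \<phi> ws + (subdivide ^^ r) \<psi> ws \<noteq> 0"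
      "length ws = Suc k" "set ws \<subseteq> facet I \<sigma> a" "\<And>j i. \<bar>\<sigma> j i\<bar> = 1"
      by (rule cell_nonzeroE) blast
    have sub: "facet I \<sigma> a \<subseteq> sphere_prod I a" using ws(4) by (rule facet_subset_sphere_prod)
    have "(subdivide ^^ r) \<phi> ws = (subdivide ^^ r) \<psi> ws"
    proof (rule iterated_subdivide_cong[OF convex_facet ws(3)])
      show "spread_le 2 ws" using ws(3) sub by (intro sphere_prod_spread) auto
    qed (use sub ws(2) assms in auto)
    then show False using ws(1) by simp
  qed
  then show ?thesis unfolding cell_add by (rule bit_add_eq_0D)
qed

section \<open>Cup products of sign cochains\<close>

text \<open>
  The cup product of the coboundaries of the 0-cochains in the list, by the formula of Alexander
  and Whitney: the first factor is evaluated on the first edge, and so on. It is meant for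
  simplices with one vertex more than there are factors.
\<close>

primrec cup :: "('a \<Rightarrow> bit) list \<Rightarrow> 'a list \<Rightarrow> bit" where
  "cup [] vs = 1"
| "cup (f # fs) vs = (f (hd vs) + f (hd (tl vs))) * cup fs (tl vs)"

lemma coboundary_cmult: "coboundary (\<lambda>ws. c * \<phi> ws) vs = c * coboundary \<phi> vs"
  by (induction vs arbitrary: \<phi>) (simp_all add: distrib_left)

text \<open>
  With \<open>c\<close> the cup product over \<open>fs\<close>, this is \<open>\<delta>(f \<union> c) = \<delta>f \<union> c + f \<union> \<delta>c\<close> for a cocycle \<open>c\<close>. It
  is also the induction step in the proof that these products are cocycles.
\<close>

lemma coboundary_cup_aux:
  assumes "length vs = length fs + 2" "coboundary (cup fs) vs = 0"
  shows "coboundary (\<lambda>ws. f (hd ws) * cup fs ws) vs = cup (f # fs) vs"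
proof -
  obtain u v rest where vs: "vs = u # v # rest"
    using assms(1) by (metis Suc_length_conv add_2_eq_Suc')
  have "cup fs (v # rest) + (cup fs (u # rest) + coboundary (\<lambda>ws. cup fs (u # v # ws)) rest) = 0"
    using assms(2) by (simp add: vs)
  then have e: "cup fs (u # rest) + coboundary (\<lambda>ws. cup fs (u # v # ws)) rest = cup fs (v # rest)"
    by (metis bit_add_eq_0D)
  have "coboundary (\<lambda>ws. f (hd ws) * cup fs ws) vs
     = f v * cup fs (v # rest) + f u * (cup fs (u # rest) + coboundary (\<lambda>ws. cup fs (u # v # ws)) rest)"
    by (simp add: vs coboundary_cmult distrib_left)
  then show ?thesis unfolding e by (simp add: vs distrib_right add.commute)
qed

lemma coboundary_cup_eq_0: "length (vs :: 'a list) = length fs + 2 \<Longrightarrow> coboundary (cup fs) vs = 0"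
proof (induction fs arbitrary: vs)
  case Nil
  then obtain u v where "vs = [u, v]"
    by (metis Suc_length_conv add_2_eq_Suc' length_0_conv list.size(3))
  then show ?case by simp
next
  case (Cons f fs)
  have "coboundary (cup (f # fs)) (vs :: 'a list) = coboundary (coboundary (\<lambda>ws. f (hd ws) * cup fs ws)) vs"
  proof (rule coboundary_cong)
    fix ws :: "'a list" assume "Suc (length ws) = length vs"
    then have "length ws = length fs + 2" using Cons.prems by simp
    then show "cup (f # fs) ws = coboundary (\<lambda>ws. f (hd ws) * cup fs ws) ws"
      using coboundary_cup_aux Cons.IH by metis
  qed
  then show ?case by (simp only: coboundary_coboundary)
qed

lemma coboundary_cup:
  "length vs = length fs + 2 \<Longrightarrow> coboundary (\<lambda>ws. f (hd ws) * cup fs ws) vs = cup (f # fs) vs"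
  by (simp only: coboundary_cup_aux coboundary_cup_eq_0)

lemma cup_nonzero:
  assumes "cup fs vs \<noteq> 0" "length vs = Suc (length fs)" "f \<in> set fs"
  shows "\<exists>u\<in>set vs. \<exists>v\<in>set vs. f u = 0 \<and> f v = 1"
  using assms
proof (induction fs arbitrary: vs)
  case (Cons g fs)
  obtain u v rest where vs: "vs = u # v # rest"
    using Cons.prems(2) by (metis Suc_length_conv length_Cons)
  have nz: "g u + g v \<noteq> 0" "cup fs (v # rest) \<noteq> 0" using Cons.prems(1) by (auto simp: vs)
  show ?case
  proof (cases "f = g")
    case True
    then show ?thesis using nz(1) vs by (cases "g u"; cases "g v") auto
  next
    case False
    then have "\<exists>u\<in>set (v # rest). \<exists>v\<in>set (v # rest). f u = 0 \<and> f v = 1"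
      using Cons.IH[OF nz(2)] Cons.prems vs by auto
    then show ?thesis using vs by auto
  qed
qed simp

text \<open>
  The points that every flip moves; a sign can be chosen equivariantly only there.
\<close>

definition free_points :: "nat set \<Rightarrow> point set" where
  "free_points I = {x. \<forall>j\<in>I. \<exists>i. x j i \<noteq> 0}"

lemma sphere_prod_subset_free_points: "sphere_prod I a \<subseteq> free_points I"
proof
  fix x assume x: "x \<in> sphere_prod I a"
  show "x \<in> free_points I"
    unfolding free_points_def
  proof (intro CollectI ballI, rule ccontr)
    fix j assume "j \<in> I" "\<nexists>i. x j i \<noteq> 0"
    then have "(\<Sum>i\<le>a j. \<bar>x j i\<bar>) = 0" by simp
    then show False using x \<open>j \<in> I\<close> by (simp add: sphere_prod_def)
  qed
qed

text \<open>
  An equivariant sign: its coboundary is invariant under all flips and represents the generator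
  \<open>w\<^sub>l\<close>.
\<close>

definition sign_cochain :: "nat set \<Rightarrow> nat \<Rightarrow> (point \<Rightarrow> bit) \<Rightarrow> bool" where
  "sign_cochain I l f \<longleftrightarrow>
     (\<forall>x\<in>free_points I. \<forall>j\<in>I. f (flip j x) = (if j = l then f x + 1 else f x))"

lemma cup_flip:
  assumes "\<And>f. f \<in> set fs \<Longrightarrow> \<exists>c. \<forall>x\<in>set vs. f (flip j x) = f x + c"
    and "length vs = Suc (length fs)"
  shows "cup fs (map (flip j) vs) = cup fs vs"
  using assms
proof (induction fs arbitrary: vs)
  case (Cons f fs)
  obtain u v rest where vs: "vs = u # v # rest"
    using Cons.prems(2) by (metis Suc_length_conv length_Cons)
  have IH: "cup fs (map (flip j) (v # rest)) = cup fs (v # rest)"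
  proof (rule Cons.IH)
    show "\<exists>c. \<forall>x\<in>set (v # rest). g (flip j x) = g x + c" if "g \<in> set fs" for g
      using Cons.prems(1)[of g] that vs by auto
  qed (use Cons.prems(2) vs in simp)
  have "f (flip j u) + f (flip j v) = f u + f v"
  proof -
    obtain c where "f (flip j u) = f u + c" "f (flip j v) = f v + c"
      using Cons.prems(1)[of f] vs by auto
    then show ?thesis by (cases "f u"; cases "f v"; cases c) simp_all
  qed
  then show ?case using IH by (simp add: vs)
qed simp

text \<open>
  Removing the first factor \<open>f\<close>, a sign for factor \<open>l\<close>, lowers the dimension of the cell by one.
  The product is the coboundary of \<open>\<psi> = f \<union> c\<close>, with \<open>c\<close> the product of the remaining factors,
  so its value is that of \<open>\<psi>\<close> on the boundary \<open>\<Sum>\<^sub>j (1 + flip\<^sub>j) e\<^sub>j\<close>. For \<open>j \<noteq> l\<close> the cochain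
  \<open>\<psi>\<close> is invariant under \<open>flip\<^sub>j\<close> and contributes twice the same value. For \<open>j = l\<close> it changes
  by \<open>c\<close>, and what remains is the value of \<open>c\<close> on \<open>e\<^sub>l\<close>.
\<close>

lemma cell_cup:
  assumes "finite I"
    and "\<And>l f. (l, f) \<in> set fs \<Longrightarrow> l \<in> I \<and> sign_cochain I l f"
    and "\<And>l. l \<in> I \<Longrightarrow> a l = count_list (map fst fs) l"
  shows "cell I (length fs) a ((subdivide ^^ r) (cup (map snd fs))) = 1"
  using assms(2,3)
proof (induction fs arbitrary: a)
  case Nil
  show ?case by (simp add: iterated_subdivide_singleton)
next
  case (Cons p fs)
  obtain l f where p: "p = (l, f)" by (cases p)
  let ?k = "length fs" and ?c = "cup (map snd fs)"
  define \<psi> where "\<psi> = (\<lambda>ws. f (hd ws) * ?c ws)"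
  have l: "l \<in> I" and f: "sign_cochain I l f" using Cons.prems(1) p by auto
  have sum_a: "sum a I = Suc ?k"
  proof -
    have "sum a I = sum (count_list (map fst (p # fs))) I"
      using Cons.prems(2) by (intro sum.cong) auto
    also have "\<dots> = length (map fst (p # fs))"
    proof (rule sum_count_set)
      show "set (map fst (p # fs)) \<subseteq> I"
      proof
        fix i assume "i \<in> set (map fst (p # fs))"
        then obtain q where "q \<in> set (p # fs)" "i = fst q" unfolding set_map by blast
        then have "(i, snd q) \<in> set (p # fs)" by (simp only: prod.collapse)
        then show "i \<in> I" using Cons.prems(1) by blast
      qed
    qed (rule assms(1))
    finally show ?thesis by simp
  qed
  have c_flip: "?c (map (flip j) ws) = ?c ws"
    if "length ws = Suc ?k" "set ws \<subseteq> free_points I" "j \<in> I" for j ws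
  proof (rule cup_flip)
    fix g assume "g \<in> set (map snd fs)"
    then obtain i where "(i, g) \<in> set fs" by auto
    then have "sign_cochain I i g" using Cons.prems(1) by auto
    then have "\<forall>x\<in>set ws. g (flip j x) = g x + (if j = i then 1 else 0)"
      using that(2,3) by (auto simp: sign_cochain_def)
    then show "\<exists>c. \<forall>x\<in>set ws. g (flip j x) = g x + c" ..
  qed (use that in simp)
  have "cell I (Suc ?k) a ((subdivide ^^ r) (cup (map snd (p # fs))))
      = cell I (Suc ?k) a ((subdivide ^^ r) (coboundary \<psi>))"
  proof (rule cell_subdivide_cong)
    fix ws :: "point list" assume "length ws = Suc (Suc ?k)"
    then show "cup (map snd (p # fs)) ws = coboundary \<psi> ws"
      using coboundary_cup[of ws "map snd fs" f] by (simp add: \<psi>_def p)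
  qed
  also have "\<dots> = (\<Sum>j\<in>{j\<in>I. a j > 0}.
     cell I ?k (a(j := a j - 1)) ((subdivide ^^ r) \<psi>) +
     cell I ?k (a(j := a j - 1)) (\<lambda>ws. (subdivide ^^ r) \<psi> (map (flip j) ws)))"
    unfolding iterated_subdivide_coboundary by (rule cell_coboundary[OF assms(1) sum_a])
  also have "\<dots> = (\<Sum>j\<in>{j\<in>I. a j > 0}. if j = l then 1 else 0)"
  proof (rule sum.cong[OF refl])
    fix j assume "j \<in> {j\<in>I. a j > 0}"
    then have j: "j \<in> I" "a j > 0" by auto
    let ?b = "a(j := a j - 1)"
    have push: "(\<lambda>ws. (subdivide ^^ r) \<psi> (map (flip j) ws)) = (subdivide ^^ r) (\<lambda>ws. \<psi> (map (flip j) ws))"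
      by (rule ext) (rule iterated_subdivide_flip)
    have flip_psi: "\<psi> (map (flip j) ws) = (if j = l then \<psi> ws + ?c ws else \<psi> ws)"
      if "length ws = Suc ?k" "set ws \<subseteq> sphere_prod I ?b" for ws
    proof -
      have free: "set ws \<subseteq> free_points I"
        using that(2) sphere_prod_subset_free_points by blast
      obtain u us where ws: "ws = u # us" using \<open>length ws = Suc ?k\<close> by (cases ws) auto
      have fu: "f (flip j u) = (if j = l then f u + 1 else f u)"
        using f free j(1) by (simp add: sign_cochain_def ws)
      have "\<psi> (map (flip j) ws) = f (flip j u) * ?c ws"
        unfolding \<psi>_def c_flip[OF that(1) free j(1)] by (simp add: ws)
      then show ?thesis unfolding fu by (simp add: \<psi>_def ws distrib_right)
    qed
    have "cell I ?k ?b (\<lambda>ws. (subdivide ^^ r) \<psi> (map (flip j) ws))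
        = cell I ?k ?b ((subdivide ^^ r) (\<lambda>ws. if j = l then \<psi> ws + ?c ws else \<psi> ws))"
      unfolding push by (rule cell_subdivide_cong) (rule flip_psi)
    also have "\<dots> = cell I ?k ?b ((subdivide ^^ r) \<psi>) + (if j = l then 1 else 0)"
    proof (cases "j = l")
      case True
      have "cell I ?k ?b ((subdivide ^^ r) ?c) = 1"
        using Cons.prems j True p by (intro Cons.IH) auto
      moreover have "(subdivide ^^ r) (\<lambda>ws. \<psi> ws + ?c ws)
          = (\<lambda>ws. (subdivide ^^ r) \<psi> ws + (subdivide ^^ r) ?c ws)"
        by (rule ext) (rule iterated_subdivide_add)
      ultimately show ?thesis using True by (simp add: cell_add)
    qed simp
    finally show "cell I ?k ?b ((subdivide ^^ r) \<psi>) +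
        cell I ?k ?b (\<lambda>ws. (subdivide ^^ r) \<psi> (map (flip j) ws)) = (if j = l then 1 else 0)"
      by simp
  qed
  also have "\<dots> = 1"
    using l assms(1) Cons.prems(2)[OF l] by (simp add: p)
  finally show ?case unfolding list.size by (simp only: add_0_right add_Suc_right)
qed

section \<open>The Borsuk-Ulam theorem for products of spheres\<close>

lemma continuous_on_coordinate: "continuous_on A (\<lambda>x :: point. x j i)"
  using continuous_on_product_then_coordinatewise[OF
      continuous_on_product_then_coordinatewise[OF continuous_on_id, of A j], of i] by simp

lemma compact_functions_into:
  fixes S :: "'b :: topological_space set"
  assumes "compact S"
  shows "compact {f :: 'a \<Rightarrow> 'b. \<forall>j. f j \<in> S}"
proof -
  have "compactin (product_topology (\<lambda>_ :: 'a. euclidean :: 'b topology) UNIV) (PiE UNIV (\<lambda>_. S))"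
    using assms by (simp add: compactin_PiE)
  moreover have "PiE UNIV (\<lambda>_ :: 'a. S) = {f. \<forall>j. f j \<in> S}" by (auto simp: PiE_def Pi_def)
  ultimately show ?thesis by (simp add: euclidean_product_topology)
qed

lemma compact_sphere_prod: "compact (sphere_prod I a)"
proof -
  have "compact {x :: point. \<forall>j. x j \<in> {y. \<forall>i. y i \<in> {-1..1}}}"
    by (intro compact_functions_into compact_Icc)
  moreover have "closed (sphere_prod I a)"
  proof -
    have "sphere_prod I a = {x. (\<forall>j i. j \<in> I \<and> i \<le> a j \<or> x j i = 0) \<and>
        (\<forall>j. j \<notin> I \<or> (\<Sum>i\<le>a j. \<bar>x j i\<bar>) = 1)}"
      by (auto simp: sphere_prod_def)
    also have "closed \<dots>"
      by (intro closed_Collect_conj closed_Collect_all closed_Collect_disj closed_Collect_const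
          closed_Collect_eq continuous_intros continuous_on_coordinate)
    finally show ?thesis .
  qed
  moreover have "sphere_prod I a \<subseteq> {x :: point. \<forall>j. x j \<in> {y. \<forall>i. y i \<in> {-1..1}}}"
  proof
    fix x assume "x \<in> sphere_prod I a"
    then have "\<bar>x j i\<bar> \<le> 1" for j i by (rule sphere_prod_abs_le_1)
    then show "x \<in> {x :: point. \<forall>j. x j \<in> {y. \<forall>i. y i \<in> {-1..1}}}" by (simp add: abs_le_iff minus_le_iff)
  qed
  ultimately show ?thesis by (metis closed_Int_compact inf.absorb1)
qed

lemma LIMSEQ_coordinatewise:
  fixes x :: "nat \<Rightarrow> point"
  assumes "\<And>j i. (\<lambda>r. x r j i) \<longlonglongrightarrow> y j i"
  shows "x \<longlonglongrightarrow> y"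
proof -
  have *: "f \<longlonglongrightarrow> g" if "\<And>j. (\<lambda>r. f r j) \<longlonglongrightarrow> g j"
    for f :: "nat \<Rightarrow> nat \<Rightarrow> 'b :: topological_space" and g
    using that limitin_componentwise[of "\<lambda>_. euclidean" UNIV f g sequentially]
    by (simp add: euclidean_product_topology)
  show ?thesis by (intro * assms)
qed

text \<open>
  The signs of the functions \<open>h p\<close> are cochains whose cup product is nonzero on some simplex of
  every subdivision of the fundamental cell. Each edge factor of the product is then nonzero, so
  every \<open>h p\<close> takes values of both signs on the vertices of that simplex.
\<close>

theorem borsuk_ulam_sphere_prod:
  fixes h :: "'p \<Rightarrow> point \<Rightarrow> real" and \<beta> :: "'p \<Rightarrow> nat"
  assumes I: "finite I" and P: "finite P" and \<beta>: "\<And>p. p \<in> P \<Longrightarrow> \<beta> p \<in> I"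
    and a: "\<And>l. l \<in> I \<Longrightarrow> a l = card {p \<in> P. \<beta> p = l}"
    and cont: "\<And>p. p \<in> P \<Longrightarrow> continuous_on (sphere_prod I a) (h p)"
    and flip: "\<And>p j x. p \<in> P \<Longrightarrow> j \<in> I \<Longrightarrow> h p (flip j x) = (if j = \<beta> p then - h p x else h p x)"
  shows "\<exists>x\<in>sphere_prod I a. \<forall>p\<in>P. h p x = 0"
proof -
  \<comment> \<open>An odd choice of sign for the points at which \<open>h p\<close> vanishes: that of the first nonzero coordinate.\<close>
  define lead where "lead l x = x l (LEAST i. x l i \<noteq> 0)" for l :: nat and x :: point
  have lead_flip: "lead l (flip j x) = (if j = l then - lead l x else lead l x)" for j l x
    by (simp add: lead_def flip_def)
  have lead_nz: "lead l x \<noteq> 0" if "x \<in> free_points I" "l \<in> I" for l x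
  proof -
    have "\<exists>i. x l i \<noteq> 0" using that by (simp add: free_points_def)
    then show ?thesis unfolding lead_def by (rule LeastI_ex)
  qed
  define sg where "sg p x = (if h p x > 0 \<or> h p x = 0 \<and> lead (\<beta> p) x > 0 then 1 else 0 :: bit)" for p x
  have sg: "sign_cochain I (\<beta> p) (sg p)" if "p \<in> P" for p
    unfolding sign_cochain_def
  proof (intro ballI)
    fix x j assume "x \<in> free_points I" "j \<in> I"
    then have "lead (\<beta> p) x \<noteq> 0" using lead_nz \<beta>[OF that] by blast
    then show "sg p (flip j x) = (if j = \<beta> p then sg p x + 1 else sg p x)"
      using flip[OF that \<open>j \<in> I\<close>, of x] by (auto simp: sg_def lead_flip)
  qed
  obtain ps where ps: "set ps = P" "distinct ps" using finite_distinct_list[OF P] by blast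
  define fs where "fs = map (\<lambda>p. (\<beta> p, sg p)) ps"
  let ?n = "Suc (length fs)"
  have count: "a l = count_list (map fst fs) l" if "l \<in> I" for l
  proof -
    have "count_list (map fst fs) l = length (filter (\<lambda>p. \<beta> p = l) ps)"
      by (simp add: fs_def count_list_eq_length_filter filter_map comp_def eq_commute)
    also have "\<dots> = card {p \<in> P. \<beta> p = l}"
      using ps by (metis distinct_card distinct_filter set_filter)
    finally show ?thesis using a[OF that] by simp
  qed
  have "\<exists>ws. length ws = ?n \<and> set ws \<subseteq> sphere_prod I a \<and> spread_le ((1 - 1 / real ?n) ^ r * 2) ws \<and>
      (\<forall>p\<in>P. \<exists>u\<in>set ws. \<exists>v\<in>set ws. h p u \<le> 0 \<and> h p v \<ge> 0)" for r
  proof -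
    have "cell I (length fs) a ((subdivide ^^ r) (cup (map snd fs))) = 1"
      using I
    proof (rule cell_cup)
      show "l \<in> I \<and> sign_cochain I l f" if "(l, f) \<in> set fs" for l f
        using that ps(1) sg \<beta> by (auto simp: fs_def)
    qed (rule count)
    then have "cell I (length fs) a ((subdivide ^^ r) (cup (map snd fs))) \<noteq> 0" by simp
    then obtain \<sigma> vs where vs: "(subdivide ^^ r) (cup (map snd fs)) vs \<noteq> 0" "length vs = ?n"
      "set vs \<subseteq> facet I \<sigma> a" "\<And>j i. \<bar>\<sigma> j i\<bar> = 1"
      by (rule cell_nonzeroE) blast
    have sub: "facet I \<sigma> a \<subseteq> sphere_prod I a" using vs(4) by (rule facet_subset_sphere_prod)
    have "spread_le 2 vs" using vs(3) sub by (intro sphere_prod_spread) auto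
    from iterated_subdivide_nonzeroD[OF vs(1,2) convex_facet vs(3) this]
    obtain ws where ws: "cup (map snd fs) ws \<noteq> 0" "length ws = ?n" "set ws \<subseteq> facet I \<sigma> a"
      "spread_le ((1 - 1 / real ?n) ^ r * 2) ws" by auto
    have "\<exists>u\<in>set ws. \<exists>v\<in>set ws. h p u \<le> 0 \<and> h p v \<ge> 0" if "p \<in> P" for p
    proof -
      have "sg p \<in> set (map snd fs)" using that ps by (auto simp: fs_def)
      then obtain u v where uv: "u \<in> set ws" "v \<in> set ws" "sg p u = 0" "sg p v = 1"
        using cup_nonzero[OF ws(1)] ws(2) by (metis length_map)
      have "h p u \<le> 0" using uv(3) by (simp add: sg_def split: if_splits)
      moreover have "h p v \<ge> 0" using uv(4) by (auto simp: sg_def split: if_splits)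
      ultimately show ?thesis using uv by blast
    qed
    then show ?thesis using ws sub by (intro exI[of _ ws]) auto
  qed
  then obtain W where W: "\<And>r. length (W r) = ?n" "\<And>r. set (W r) \<subseteq> sphere_prod I a"
    "\<And>r. spread_le ((1 - 1 / real ?n) ^ r * 2) (W r)"
    "\<And>r p. p \<in> P \<Longrightarrow> \<exists>u\<in>set (W r). \<exists>v\<in>set (W r). h p u \<le> 0 \<and> h p v \<ge> 0"
    by metis
  have hd_W: "hd (W r) \<in> set (W r)" for r using W(1)[of r] by (intro hd_in_set) auto
  then have "\<forall>r. hd (W r) \<in> sphere_prod I a" using W(2) by blast
  then obtain x s where x: "x \<in> sphere_prod I a" "strict_mono s" "((\<lambda>r. hd (W r)) \<circ> s) \<longlonglongrightarrow> x"
    using compact_imp_seq_compact[OF compact_sphere_prod] unfolding seq_compact_def by metis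
  \<comment> \<open>As the simplices shrink, all choices of vertices have the same limit.\<close>
  have lim: "y \<longlonglongrightarrow> x" if y: "\<And>r. y r \<in> set (W (s r))" for y
  proof (rule LIMSEQ_coordinatewise)
    fix j i
    have small: "(\<lambda>r. (1 - 1 / real ?n) ^ r * 2) \<longlonglongrightarrow> 0"
      by (intro tendsto_mult_left_zero LIMSEQ_power_zero) (simp add: field_simps)
    have bound: "(\<lambda>r. (1 - 1 / real ?n) ^ s r * 2) \<longlonglongrightarrow> 0"
      using LIMSEQ_subseq_LIMSEQ[OF small x(2)] by (simp add: comp_def)
    have "norm (y r j i - hd (W (s r)) j i) \<le> (1 - 1 / real ?n) ^ s r * 2" for r
      using W(3)[of "s r"] y[of r] hd_W[of "s r"] by (simp only: spread_le_def real_norm_def)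
    then have "\<forall>\<^sub>F r in sequentially. norm (y r j i - hd (W (s r)) j i) \<le> (1 - 1 / real ?n) ^ s r * 2"
      by (intro always_eventually allI)
    from Lim_null_comparison[OF this bound]
    have "(\<lambda>r. y r j i - hd (W (s r)) j i) \<longlonglongrightarrow> 0" .
    moreover have "(\<lambda>r. hd (W (s r)) j i) \<longlonglongrightarrow> x j i"
      using continuous_on_tendsto_compose[OF continuous_on_coordinate x(3) UNIV_I always_eventually, of j i]
      unfolding comp_def by (simp only: UNIV_I simp_thms)
    ultimately show "(\<lambda>r. y r j i) \<longlonglongrightarrow> x j i"
      by (rule Lim_transform[rotated])
  qed
  have "h p x = 0" if p: "p \<in> P" for p
  proof -
    have "\<forall>r. \<exists>u v. u \<in> set (W (s r)) \<and> v \<in> set (W (s r)) \<and> h p u \<le> 0 \<and> h p v \<ge> 0"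
      using W(4)[OF p] by blast
    then obtain y z where yz: "\<And>r. y r \<in> set (W (s r))" "\<And>r. z r \<in> set (W (s r))"
      "\<And>r. h p (y r) \<le> 0" "\<And>r. h p (z r) \<ge> 0"
      by metis
    have tends: "(\<lambda>r. h p (w r)) \<longlonglongrightarrow> h p x" if w: "\<And>r. w r \<in> set (W (s r))" for w
    proof (rule continuous_on_tendsto_compose[OF cont[OF p] lim[OF w] x(1)])
      have "w r \<in> sphere_prod I a" for r using W(2) w by blast
      then show "\<forall>\<^sub>F r in sequentially. w r \<in> sphere_prod I a" by (intro always_eventually allI)
    qed
    have "h p x \<le> 0" using tends[OF yz(1)] yz(3) by (intro LIMSEQ_le_const2) auto
    moreover have "h p x \<ge> 0" using tends[OF yz(2)] yz(4) by (intro LIMSEQ_le_const) auto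
    ultimately show ?thesis by simp
  qed
  then show ?thesis using x(1) by blast
qed

section \<open>Convex hulls of sets with disjoint supports\<close>

lemma sum_fun_apply: "(\<Sum>t\<in>T. f t) w = (\<Sum>t\<in>T. f t w :: real)"
  by (induction T rule: infinite_finite_induct) auto

text \<open>
  The supports are disjoint, so \<open>\<bar>\<Sum>\<^sub>t k t * t\<bar> = \<Sum>\<^sub>t \<bar>k t\<bar> * t\<close>; summing over \<open>V\<close> shows that the
  coefficients \<open>\<bar>k t\<bar>\<close> add up to 1.
\<close>

lemma abs_in_hull_of_span:
  assumes T: "T \<in> disjoint_supp_sets d V" and V: "finite V"
    and x: "\<And>v. x v = (\<Sum>t\<in>T. k t * t v)" "(\<Sum>v\<in>V. \<bar>x v\<bar>) = 1"
  shows "(\<lambda>v. \<bar>x v\<bar>) \<in> convex hull T"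
proof -
  have fT: "finite T" and sT: "\<And>t. t \<in> T \<Longrightarrow> t \<in> std_simplex V"
    and disj: "\<And>s t. s \<in> T \<Longrightarrow> t \<in> T \<Longrightarrow> s \<noteq> t \<Longrightarrow> disjnt (supp s) (supp t)"
    using T by (auto simp: disjoint_supp_sets_def pairwise_def)
  have nn: "t v \<ge> 0" if "t \<in> T" for t v
    using sT[OF that] by (cases "v \<in> V") (auto simp: std_simplex_def real_space_def)
  have abs: "\<bar>x v\<bar> = (\<Sum>t\<in>T. \<bar>k t\<bar> * t v)" for v
  proof (cases "\<exists>t\<in>T. t v \<noteq> 0")
    case False
    then have "(\<Sum>t\<in>T. c t * t v) = 0" for c :: "('a \<Rightarrow> real) \<Rightarrow> real"
      by (intro sum.neutral) auto
    then show ?thesis by (simp add: x(1))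
  next
    case True
    then obtain s where s: "s \<in> T" "s v \<noteq> 0" by blast
    have z: "t v = 0" if "t \<in> T - {s}" for t
      using disj[of s t] s that by (auto simp: disjnt_iff supp_def)
    have "(\<Sum>t\<in>T. c t * t v) = c s * s v" for c :: "('a \<Rightarrow> real) \<Rightarrow> real"
    proof -
      have "(\<Sum>t\<in>T - {s}. c t * t v) = 0" using z by (intro sum.neutral) simp
      then show ?thesis by (simp add: sum.remove[OF fT s(1)])
    qed
    then show ?thesis using nn[OF s(1), of v] by (simp add: x(1) abs_mult)
  qed
  have "(\<Sum>t\<in>T. \<bar>k t\<bar>) = (\<Sum>t\<in>T. \<bar>k t\<bar> * (\<Sum>v\<in>V. t v))"
    using sT by (intro sum.cong) (auto simp: std_simplex_def)
  also have "\<dots> = (\<Sum>v\<in>V. \<bar>x v\<bar>)"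
    unfolding abs sum_distrib_left by (rule sum.swap)
  finally have "(\<Sum>t\<in>T. \<bar>k t\<bar>) = 1" using x(2) by simp
  moreover have "(\<lambda>v. \<bar>x v\<bar>) = (\<Sum>t\<in>T. \<bar>k t\<bar> *\<^sub>R t)"
    by (rule ext) (simp add: abs sum_fun_apply scaleR_fun_def)
  ultimately show ?thesis
    unfolding convex_hull_finite[OF fT] by (intro CollectI exI[of _ "\<lambda>t. \<bar>k t\<bar>"]) auto
qed

text \<open>
  Choose a pivot \<open>\<pi> t\<close> in the support of each \<open>t \<in> T\<close>. The pivots are distinct, and \<open>d\<close> elements
  of \<open>V\<close> are not pivots. If \<open>x\<close> is in the span of \<open>T\<close>, its coefficient at \<open>t\<close> must be
  \<open>x (\<pi> t) / t (\<pi> t)\<close>; the equations say that this combination agrees with \<open>x\<close> at the elements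
  that are not pivots, and at the pivots it always does.
\<close>

lemma span_equations:
  assumes T: "T \<in> disjoint_supp_sets d V" and V: "finite V"
  shows "\<exists>c :: nat \<Rightarrow> 'v \<Rightarrow> real. \<forall>x\<in>real_space V.
     (\<forall>i<d. (\<Sum>v\<in>V. c i v * x v) = 0) \<longrightarrow> (\<exists>k. \<forall>v. x v = (\<Sum>t\<in>T. k t * t v))"
proof -
  have fT: "finite T" and sT: "\<And>t. t \<in> T \<Longrightarrow> t \<in> std_simplex V"
    and disj: "\<And>s t. s \<in> T \<Longrightarrow> t \<in> T \<Longrightarrow> s \<noteq> t \<Longrightarrow> disjnt (supp s) (supp t)"
    and cT: "card V = card T + d"
    using T by (auto simp: disjoint_supp_sets_def pairwise_def)
  have "\<exists>v\<in>V. t v \<noteq> 0" if "t \<in> T" for t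
  proof (rule ccontr)
    assume "\<not> (\<exists>v\<in>V. t v \<noteq> 0)"
    then have "(\<Sum>v\<in>V. t v) = 0" by simp
    then show False using sT[OF that] by (simp add: std_simplex_def)
  qed
  then obtain \<pi> where \<pi>: "\<And>t. t \<in> T \<Longrightarrow> \<pi> t \<in> V" "\<And>t. t \<in> T \<Longrightarrow> t (\<pi> t) \<noteq> 0" by metis
  have other: "t (\<pi> s) = 0" if "s \<in> T" "t \<in> T" "s \<noteq> t" for s t
    using disj[OF that] \<pi>(2)[OF that(1)] by (auto simp: disjnt_iff supp_def)
  have "inj_on \<pi> T" by (rule inj_onI) (use other \<pi>(2) in metis)
  then have "card (V - \<pi> ` T) = d"
    using cT \<pi>(1) fT by (subst card_Diff_subset) (auto simp: card_image)
  then obtain e where e: "bij_betw e {..<d} (V - \<pi> ` T)"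
    using V ex_bij_betw_nat_finite[of "V - \<pi> ` T"] by (auto simp: atLeast0LessThan)
  \<comment> \<open>The coefficients of the form \<open>x \<mapsto> x (e i) - (\<Sum>t\<in>T. x (\<pi> t) / t (\<pi> t) * t (e i))\<close>.\<close>
  define c where "c i v = (if v = e i then 1 else 0) -
      (\<Sum>t\<in>T. t (e i) / t (\<pi> t) * (if v = \<pi> t then 1 else 0))" for i v
  have "\<exists>k. \<forall>v. x v = (\<Sum>t\<in>T. k t * t v)"
    if x: "x \<in> real_space V" and zero: "\<forall>i<d. (\<Sum>v\<in>V. c i v * x v) = 0" for x
  proof (intro exI allI)
    fix w
    consider "w \<notin> V" | s where "s \<in> T" "w = \<pi> s" | i where "i < d" "w = e i"
      using e unfolding bij_betw_def by blast
    then show "x w = (\<Sum>t\<in>T. (\<lambda>t. x (\<pi> t) / t (\<pi> t)) t * t w)"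
    proof cases
      case 1
      have "t w = 0" if "t \<in> T" for t
        using sT[OF that] 1 by (simp add: std_simplex_def real_space_def)
      then have "(\<Sum>t\<in>T. (\<lambda>t. x (\<pi> t) / t (\<pi> t)) t * t w) = 0" by (intro sum.neutral) simp
      then show ?thesis using x 1 by (simp add: real_space_def)
    next
      case 2
      have "(\<Sum>t\<in>T - {s}. x (\<pi> t) / t (\<pi> t) * t w) = 0"
        using other 2 by (intro sum.neutral) auto
      then show ?thesis using 2 \<pi>(2)[OF 2(1)] by (simp add: sum.remove[OF fT 2(1)])
    next
      case 3
      have "e i \<in> V" using e 3(1) by (auto simp: bij_betw_def)
      have "0 = (\<Sum>v\<in>V. c i v * x v)" using zero 3(1) by simp
      also have "\<dots> = (\<Sum>v\<in>V. if v = e i then x v else 0) -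
          (\<Sum>v\<in>V. \<Sum>t\<in>T. if v = \<pi> t then t (e i) / t (\<pi> t) * x v else 0)"
        unfolding sum_subtractf[symmetric]
        by (rule sum.cong[OF refl])
          (auto simp: c_def left_diff_distrib sum_distrib_right intro!: sum.cong)
      also have "(\<Sum>v\<in>V. \<Sum>t\<in>T. if v = \<pi> t then t (e i) / t (\<pi> t) * x v else 0)
          = (\<Sum>t\<in>T. \<Sum>v\<in>V. if v = \<pi> t then t (e i) / t (\<pi> t) * x v else 0)"
        by (rule sum.swap)
      also have "\<dots> = (\<Sum>t\<in>T. t (e i) / t (\<pi> t) * x (\<pi> t))"
        using \<pi>(1) V by (intro sum.cong) auto
      finally show ?thesis
        using \<open>e i \<in> V\<close> V by (simp add: 3(2) mult.commute)
    qed
  qed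
  then show ?thesis by blast
qed

lemma hull_equations:
  assumes T: "T \<in> disjoint_supp_sets d V" and V: "finite V"
  shows "\<exists>c :: nat \<Rightarrow> 'v \<Rightarrow> real. \<forall>x\<in>real_space V. (\<Sum>v\<in>V. \<bar>x v\<bar>) = 1 \<longrightarrow>
     (\<forall>i<d. (\<Sum>v\<in>V. c i v * x v) = 0) \<longrightarrow> (\<lambda>v. \<bar>x v\<bar>) \<in> convex hull T"
proof -
  obtain c :: "nat \<Rightarrow> 'v \<Rightarrow> real" where c: "\<forall>x\<in>real_space V.
     (\<forall>i<d. (\<Sum>v\<in>V. c i v * x v) = 0) \<longrightarrow> (\<exists>k. \<forall>v. x v = (\<Sum>t\<in>T. k t * t v))"
    using span_equations[OF assms] by blast
  show ?thesis
  proof (intro exI[of _ c] ballI impI)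
    fix x assume x: "x \<in> real_space V" "(\<Sum>v\<in>V. \<bar>x v\<bar>) = 1" "\<forall>i<d. (\<Sum>v\<in>V. c i v * x v) = 0"
    then obtain k where k: "\<forall>v. x v = (\<Sum>t\<in>T. k t * t v)" using c by blast
    show "(\<lambda>v. \<bar>x v\<bar>) \<in> convex hull T"
      by (rule abs_in_hull_of_span[OF assms k[rule_format] x(2)])
  qed
qed

section \<open>From cross-polytopes to simplices\<close>

text \<open>
  The distance to the complement serves, except when the complement is empty and that distance
  is zero by convention.
\<close>

lemma nonzero_function_on_openin:
  fixes S :: "'a :: metric_space set"
  assumes "closed S" "openin (top_of_set S) U"
  shows "\<exists>\<phi>. continuous_on S \<phi> \<and> (\<forall>x\<in>S. \<phi> x \<noteq> (0::real) \<longleftrightarrow> x \<in> U)"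
proof (cases "S \<subseteq> U")
  case True
  then show ?thesis by (intro exI[of _ "\<lambda>_. 1"]) auto
next
  case False
  have "closedin (top_of_set S) (S - U)"
    using assms(2) by (metis closedin_diff closedin_topspace topspace_euclidean_subtopology)
  then have "closed (S - U)" using assms(1) by (metis closedin_closed_trans)
  then have "infdist x (S - U) = 0 \<longleftrightarrow> x \<in> S - U" for x
    using False in_closed_iff_infdist_zero by (metis Diff_eq_empty_iff)
  then show ?thesis
    using continuous_on_infdist[OF continuous_on_id, of S "S - U"]
    by (intro exI[of _ "\<lambda>x. infdist x (S - U)"]) simp
qed

definition abs_point :: "point \<Rightarrow> point" where
  "abs_point x = (\<lambda>l i. \<bar>x l i\<bar>)"

lemma abs_point_flip [simp]: "abs_point (flip j x) = abs_point x"
  by (auto simp: abs_point_def flip_def fun_eq_iff)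

lemma abs_point_idem [simp]: "abs_point (abs_point x) = abs_point x"
  by (simp add: abs_point_def)

lemma abs_point_in_sphere_prod: "x \<in> sphere_prod I a \<Longrightarrow> abs_point x \<in> sphere_prod I a"
  by (simp add: abs_point_def sphere_prod_def)

lemma continuous_on_abs_point: "continuous_on A abs_point"
  unfolding abs_point_def
  by (intro continuous_on_coordinatewise_then_product continuous_intros continuous_on_coordinate)

text \<open>
  The map \<open>x \<mapsto> \<bar>x\<bar>\<close> from the product of spheres to \<open>Y\<close>, for enumerations \<open>ix l\<close> of the vertex
  sets. The spheres have coordinates indexed by natural numbers because fundamental chains need
  an order of the vertices and because countably many coordinates give a metrizable space, in
  which compactness is sequential.
\<close>

definition to_simplices :: "nat set \<Rightarrow> (nat \<Rightarrow> 'v set) \<Rightarrow> (nat \<Rightarrow> 'v \<Rightarrow> nat) \<Rightarrow> point \<Rightarrow> nat \<Rightarrow> 'v \<Rightarrow> real" where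
  "to_simplices I V ix x = (\<lambda>l\<in>I. \<lambda>v. if v \<in> V l then \<bar>x l (ix l v)\<bar> else 0)"

lemma to_simplices_in_std_simplex:
  assumes "x \<in> sphere_prod I N" "l \<in> I" "bij_betw (ix l) (V l) {..N l}"
  shows "to_simplices I V ix x l \<in> std_simplex (V l)" "(\<Sum>v\<in>V l. \<bar>x l (ix l v)\<bar>) = 1"
proof -
  have "(\<Sum>v\<in>V l. \<bar>x l (ix l v)\<bar>) = (\<Sum>i\<le>N l. \<bar>x l i\<bar>)"
    by (rule sum.reindex_bij_betw[OF assms(3)])
  then show s: "(\<Sum>v\<in>V l. \<bar>x l (ix l v)\<bar>) = 1" using assms(1,2) by (simp add: sphere_prod_def)
  show "to_simplices I V ix x l \<in> std_simplex (V l)"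
    using assms(2) s by (simp add: to_simplices_def std_simplex_def real_space_def)
qed

lemma continuous_map_to_simplices:
  assumes "\<And>l. l \<in> I \<Longrightarrow> bij_betw (ix l) (V l) {..N l}"
  shows "continuous_map (top_of_set (sphere_prod I N))
    (product_topology (\<lambda>l. top_of_set (std_simplex (V l))) I) (to_simplices I V ix)"
  unfolding continuous_map_componentwise
proof (intro conjI ballI)
  show "to_simplices I V ix ` topspace (top_of_set (sphere_prod I N)) \<subseteq> extensional I"
    by (auto simp: to_simplices_def)
  fix l assume l: "l \<in> I"
  have "continuous_on (sphere_prod I N) (\<lambda>x. to_simplices I V ix x l)"
  proof (rule continuous_on_coordinatewise_then_product)
    fix v
    show "continuous_on (sphere_prod I N) (\<lambda>x. to_simplices I V ix x l v)"
      using l by (cases "v \<in> V l")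
        (auto simp: to_simplices_def intro!: continuous_intros continuous_on_coordinate)
  qed
  then show "continuous_map (top_of_set (sphere_prod I N)) (top_of_set (std_simplex (V l)))
      (\<lambda>x. to_simplices I V ix x l)"
    using to_simplices_in_std_simplex(1)[of _ I N l ix V] l assms[OF l]
    by (auto simp: continuous_map_in_subtopology)
qed

section \<open>Intersections of images of simplices\<close>

theorem theorem4p2:
  fixes V :: "nat \<Rightarrow> 'v set"
    and d n :: "nat \<Rightarrow> nat"
    and m :: nat
    and Z :: "'z topology"
    and g :: "(nat \<Rightarrow> 'v \<Rightarrow> real) \<Rightarrow> 'z"
  assumes "m \<ge> 1"
    and "\<And>l. l \<in> {1..m} \<Longrightarrow> finite (V l)"
    and "\<And>l. l \<in> {1..m} \<Longrightarrow> d l \<ge> 1"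
    and "\<And>l. l \<in> {1..m} \<Longrightarrow> n l \<ge> 1"
    and "\<And>l. l \<in> {1..m} \<Longrightarrow> card (V l) = d l * n l + 1"
    and "compact_space Z"
    and "Hausdorff_space Z"
    and "covering_dim_less Z (\<Sum>l\<in>{1..m}. n l)"
    and "continuous_map (product_topology (\<lambda>l. top_of_set (std_simplex (V l))) {1..m}) Z g"
  shows "\<exists>l\<in>{1..m}.
    (\<Inter>T\<in>disjoint_supp_sets (d l) (V l).
       g ` (\<Pi>\<^sub>E j\<in>{1..m}. if j = l then convex hull T else std_simplex (V j))) \<noteq> {}"
proof (rule ccontr)
  define I where "I = {1..m}"
  define N where "N l = d l * n l" for l
  define S where "S = sphere_prod I N"
  define img where "img l T = g ` (\<Pi>\<^sub>E j\<in>I. if j = l then convex hull T else std_simplex (V j))" for l T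
  assume "\<not> ?thesis"
  then have empty: "\<And>l. l \<in> I \<Longrightarrow> (\<Inter>T\<in>disjoint_supp_sets (d l) (V l). img l T) = {}"
    by (auto simp: I_def img_def)
  have I: "finite I" by (simp add: I_def)
  note finV = assms(2)[folded I_def] and cardV = assms(5)[folded I_def]

  have "\<exists>f. bij_betw f (V l) {..N l}" if "l \<in> I" for l
  proof -
    have "\<exists>f. bij_betw f (V l) {0..<card (V l)}" using finV[OF that] by (rule ex_bij_betw_finite_nat)
    moreover have "{0..<card (V l)} = {..N l}" using cardV[OF that] by (auto simp: N_def)
    ultimately show ?thesis by simp
  qed
  then obtain ix where ix: "\<And>l. l \<in> I \<Longrightarrow> bij_betw (ix l) (V l) {..N l}" by metis
  \<comment> \<open>\<open>F\<close> is \<open>g\<close> pulled back to the product of spheres; it is even in every factor.\<close>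
  define F where "F x = g (to_simplices I V ix x)" for x
  have F_abs: "F (abs_point x) = F x" for x
    by (simp add: F_def to_simplices_def abs_point_def cong: if_cong)
  have contF: "continuous_map (top_of_set S) Z F"
  proof -
    have "F = g \<circ> to_simplices I V ix" by (rule ext) (simp add: F_def)
    then show ?thesis
      using continuous_map_compose[OF continuous_map_to_simplices[of I ix V N] assms(9)[folded I_def]] ix
      by (simp add: S_def)
  qed

  have "\<exists>c. \<forall>x\<in>real_space (V l). (\<Sum>v\<in>V l. \<bar>x v\<bar>) = 1 \<longrightarrow>
     (\<forall>i<d l. (\<Sum>v\<in>V l. c i v * x v) = 0) \<longrightarrow> (\<lambda>v. \<bar>x v\<bar>) \<in> convex hull T"
    if "l \<in> I" "T \<in> disjoint_supp_sets (d l) (V l)" for l T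
    using hull_equations[OF that(2) finV[OF that(1)]] .
  then obtain c where c: "\<And>l T x. \<lbrakk>l \<in> I; T \<in> disjoint_supp_sets (d l) (V l); x \<in> real_space (V l);
      (\<Sum>v\<in>V l. \<bar>x v\<bar>) = 1; \<forall>i<d l. (\<Sum>v\<in>V l. c l T i v * x v) = 0\<rbrakk>
      \<Longrightarrow> (\<lambda>v. \<bar>x v\<bar>) \<in> convex hull T"
    by metis
  define lam where "lam l T i x = (\<Sum>v\<in>V l. c l T i v * x l (ix l v))" for l T i and x :: point
  have lam_flip: "lam l T i (flip j x) = (if j = l then - lam l T i x else lam l T i x)" for l T i j x
    by (simp add: lam_def flip_def sum_negf)
  have cont_lam: "continuous_on A (lam l T i)" for A l T i
    unfolding lam_def by (intro continuous_intros continuous_on_coordinate)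

  \<comment> \<open>The forms vanish on \<open>K l T\<close>, whose image is therefore contained in the image belonging to \<open>T\<close>.
    Working with \<open>K l T\<close>, a compact subset of the product of spheres, gives closed sets in \<open>Z\<close>.\<close>
  define K where "K l T = {x \<in> S. \<forall>i<d l. lam l T i x = 0}" for l T
  have compK: "compact (K l T)" for l T
  proof -
    have "closed {x. \<forall>i. \<not> i < d l \<or> lam l T i x = 0}"
      by (intro closed_Collect_all closed_Collect_disj closed_Collect_const closed_Collect_eq
          cont_lam continuous_on_const)
    then have "compact (S \<inter> {x. \<forall>i. \<not> i < d l \<or> lam l T i x = 0})"
      unfolding S_def by (intro compact_Int_closed compact_sphere_prod)
    moreover have "S \<inter> {x. \<forall>i. \<not> i < d l \<or> lam l T i x = 0} = K l T" by (auto simp: K_def)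
    ultimately show ?thesis by simp
  qed
  have closedFK: "closedin Z (F ` K l T)" for l T
  proof -
    have "compactin (top_of_set S) (K l T)"
      using compK by (simp add: compactin_subtopology K_def)
    then have "compactin Z (F ` K l T)" using contF by (rule image_compactin)
    then show ?thesis using assms(7) by (rule compactin_imp_closedin[rotated])
  qed
  have FK: "F ` K l T \<subseteq> img l T" if l: "l \<in> I" and T: "T \<in> disjoint_supp_sets (d l) (V l)" for l T
  proof
    fix z assume "z \<in> F ` K l T"
    then obtain x where x: "x \<in> S" "\<forall>i<d l. lam l T i x = 0" "z = F x" by (auto simp: K_def)
    define t where "t = (\<lambda>v. if v \<in> V l then x l (ix l v) else 0)"
    have "(\<lambda>v. \<bar>t v\<bar>) \<in> convex hull T"
    proof (rule c[OF l T])
      show "(\<Sum>v\<in>V l. \<bar>t v\<bar>) = 1"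
        using to_simplices_in_std_simplex(2)[of x I N l ix V] x(1) l ix[OF l] by (simp add: S_def t_def)
      show "\<forall>i<d l. (\<Sum>v\<in>V l. c l T i v * t v) = 0" using x(2) by (simp add: lam_def t_def)
    qed (simp add: t_def real_space_def)
    moreover have "to_simplices I V ix x l = (\<lambda>v. \<bar>t v\<bar>)"
      using l by (auto simp: to_simplices_def t_def)
    ultimately have "to_simplices I V ix x l \<in> convex hull T" by simp
    then have "to_simplices I V ix x \<in> (\<Pi>\<^sub>E j\<in>I. if j = l then convex hull T else std_simplex (V j))"
      using to_simplices_in_std_simplex(1)[of x I N _ ix V] x(1) ix by (auto simp: S_def to_simplices_def[of I])
    then show "z \<in> img l T" by (auto simp: x(3) F_def img_def)
  qed

  \<comment> \<open>One set \<open>\<tau> l\<close> has to be chosen for every factor at once, hence a cover indexed by families \<open>\<tau>\<close>.\<close>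
  define U where "U \<tau> = {z \<in> topspace Z. \<forall>l\<in>I. z \<notin> F ` K l (\<tau> l)}" for \<tau> :: "nat \<Rightarrow> ('v \<Rightarrow> real) set"
  define \<T> where "\<T> = {\<tau>. \<forall>l\<in>I. \<tau> l \<in> disjoint_supp_sets (d l) (V l)}"
  have openU: "openin Z (U \<tau>)" for \<tau>
  proof -
    have "U \<tau> = topspace Z - (\<Union>l\<in>I. F ` K l (\<tau> l))" by (auto simp: U_def)
    moreover have "closedin Z (\<Union>l\<in>I. F ` K l (\<tau> l))" using I closedFK by (intro closedin_Union) auto
    ultimately show ?thesis by (simp add: openin_diff)
  qed
  have coverU: "\<Union> (U ` \<T>) = topspace Z"
  proof
    show "topspace Z \<subseteq> \<Union> (U ` \<T>)"
    proof
      fix z assume z: "z \<in> topspace Z"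
      have "\<forall>l\<in>I. \<exists>T\<in>disjoint_supp_sets (d l) (V l). z \<notin> img l T" using empty by blast
      then obtain \<tau> where \<tau>: "\<forall>l\<in>I. \<tau> l \<in> disjoint_supp_sets (d l) (V l) \<and> z \<notin> img l (\<tau> l)" by metis
      then have "\<tau> \<in> \<T>" by (simp add: \<T>_def)
      moreover have "\<forall>l\<in>I. z \<notin> F ` K l (\<tau> l)" using \<tau> FK by blast
      then have "z \<in> U \<tau>" using z by (simp add: U_def)
      ultimately show "z \<in> \<Union> (U ` \<T>)" by blast
    qed
  qed (auto simp: U_def)
  have "(\<forall>U'\<in>U ` \<T>. openin Z U') \<and> \<Union> (U ` \<T>) = topspace Z"
    using openU coverU by blast
  from assms(8)[folded I_def, unfolded covering_dim_less_def, THEN spec, THEN mp, OF this]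
  obtain \<W> where \<W>: "finite \<W>" "\<forall>W\<in>\<W>. openin Z W" "\<Union>\<W> = topspace Z"
    "\<forall>W\<in>\<W>. \<exists>\<tau>\<in>\<T>. W \<subseteq> U \<tau>" "\<forall>z\<in>topspace Z. card {W \<in> \<W>. z \<in> W} \<le> sum n I"
    by (auto simp only: bex_simps image_iff)
  then obtain \<tau> where \<tau>: "\<And>W. W \<in> \<W> \<Longrightarrow> \<tau> W \<in> \<T> \<and> W \<subseteq> U (\<tau> W)" by metis

  have "\<exists>\<phi>. continuous_on S \<phi> \<and> (\<forall>x\<in>S. \<phi> x \<noteq> (0::real) \<longleftrightarrow> F x \<in> W)" if "W \<in> \<W>" for W
  proof -
    have "openin (top_of_set S) {x \<in> S. F x \<in> W}"
      using openin_continuous_map_preimage[OF contF] \<W>(2) that by fastforce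
    moreover have "closed S" unfolding S_def by (intro compact_imp_closed compact_sphere_prod)
    ultimately obtain \<phi> where "continuous_on S \<phi>" "\<forall>x\<in>S. \<phi> x \<noteq> (0::real) \<longleftrightarrow> x \<in> {x \<in> S. F x \<in> W}"
      using nonzero_function_on_openin[of S "{x \<in> S. F x \<in> W}"] by blast
    then show ?thesis by auto
  qed
  then obtain \<phi> where \<phi>: "\<And>W. W \<in> \<W> \<Longrightarrow> continuous_on S (\<phi> W)"
    "\<And>W x. W \<in> \<W> \<Longrightarrow> x \<in> S \<Longrightarrow> \<phi> W x \<noteq> (0::real) \<longleftrightarrow> F x \<in> W"
    by metis

  \<comment> \<open>Distribute the colours \<open>1, \<dots>, n\<close> over the factors: \<open>\<beta> k\<close> is the factor that receives colour \<open>k\<close>.\<close>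
  have "card (Sigma I (\<lambda>l. {..<n l})) = sum n I" using I by (simp add: card_SigmaI)
  then obtain \<kappa> where \<kappa>: "bij_betw \<kappa> {1..sum n I} (Sigma I (\<lambda>l. {..<n l}))"
    using ex_bij_betw_nat_finite_1[of "Sigma I (\<lambda>l. {..<n l})"] I by auto
  define \<beta> where "\<beta> k = fst (\<kappa> k)" for k
  have \<beta>: "\<beta> k \<in> I" if "k \<in> {1..sum n I}" for k
    using bij_betwE[OF \<kappa>] that by (fastforce simp: \<beta>_def)
  have card_\<beta>: "card {k \<in> {1..sum n I}. \<beta> k = l} = n l" if "l \<in> I" for l
  proof -
    have "bij_betw \<kappa> {k \<in> {1..sum n I}. \<beta> k = l} ({l} \<times> {..<n l})"
    proof (rule bij_betw_subset[OF \<kappa>])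
      have "\<kappa> ` {k \<in> {1..sum n I}. \<beta> k = l} = {q \<in> \<kappa> ` {1..sum n I}. fst q = l}"
        by (auto simp: \<beta>_def)
      also have "\<kappa> ` {1..sum n I} = Sigma I (\<lambda>l. {..<n l})" using \<kappa> by (simp add: bij_betw_def)
      also have "{q \<in> Sigma I (\<lambda>l. {..<n l}). fst q = l} = {l} \<times> {..<n l}"
        using that by auto
      finally show "\<kappa> ` {k \<in> {1..sum n I}. \<beta> k = l} = {l} \<times> {..<n l}" .
    qed auto
    then have "card {k \<in> {1..sum n I}. \<beta> k = l} = card ({l} \<times> {..<n l})" by (rule bij_betw_same_card)
    then show ?thesis by simp
  qed

  define P where "P = Sigma {1..sum n I} (\<lambda>k. {..<d (\<beta> k)})"
  define pick where "pick \<sigma> = (SOME W. W \<in> \<sigma>)" for \<sigma> :: "'z set set"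
  define h where "h = (\<lambda>(k, i) x. \<Sum>\<sigma>\<in>{\<sigma>. \<sigma> \<subseteq> \<W> \<and> card \<sigma> = k}.
      (\<Prod>W\<in>\<sigma>. \<phi> W (abs_point x)) * lam (\<beta> k) (\<tau> (pick \<sigma>) (\<beta> k)) i x)"
  have "\<exists>x\<in>sphere_prod I N. \<forall>p\<in>P. h p x = 0"
  proof (rule borsuk_ulam_sphere_prod[where \<beta> = "\<beta> \<circ> fst"])
    show "finite I" "finite P" by (auto simp: I_def P_def)
    show "(\<beta> \<circ> fst) p \<in> I" if "p \<in> P" for p using \<beta> that by (auto simp: P_def)
    show "N l = card {p \<in> P. (\<beta> \<circ> fst) p = l}" if "l \<in> I" for l
    proof -
      have "{p \<in> P. (\<beta> \<circ> fst) p = l} = {k \<in> {1..sum n I}. \<beta> k = l} \<times> {..<d l}"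
        by (auto simp: P_def)
      then show ?thesis using card_\<beta>[OF that] by (simp add: card_cartesian_product N_def)
    qed
    show "continuous_on (sphere_prod I N) (h p)" for p
    proof -
      obtain k i where p: "p = (k, i)" by (cases p)
      have "continuous_on S (\<lambda>x. \<phi> W (abs_point x))" if "W \<in> \<W>" for W
        using continuous_on_compose2[OF \<phi>(1)[OF that] continuous_on_abs_point]
          abs_point_in_sphere_prod by (metis S_def image_subsetI)
      then show ?thesis
        unfolding h_def p split_conv S_def[symmetric]
        by (intro continuous_on_sum continuous_on_mult continuous_on_prod cont_lam) auto
    qed
    show "h p (flip j x) = (if j = (\<beta> \<circ> fst) p then - h p x else h p x)" for p j x
      by (cases p) (simp add: h_def lam_flip sum_negf)
  qed
  then obtain x where x: "x \<in> S" and zero: "\<And>p. p \<in> P \<Longrightarrow> h p x = 0" by (auto simp: S_def)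

  \<comment> \<open>At a common zero \<open>x\<close>, look at the equations for the colour \<open>k\<close> of \<open>x\<close>.\<close>
  define \<sigma> where "\<sigma> = {W \<in> \<W>. F x \<in> W}"
  define k where "k = card \<sigma>"
  have Fx: "F x \<in> topspace Z" using contF x by (auto simp: continuous_map_def)
  have fin\<sigma>: "finite \<sigma>" using \<W>(1) by (simp add: \<sigma>_def)
  have ne: "\<sigma> \<noteq> {}" using Fx \<W>(3) by (auto simp: \<sigma>_def)
  have k: "k \<in> {1..sum n I}"
    using ne fin\<sigma> \<W>(5) Fx by (auto simp: k_def \<sigma>_def Suc_le_eq card_gt_0_iff)
  define l where "l = \<beta> k"
  have l: "l \<in> I" using \<beta>[OF k] by (simp add: l_def)
  have pick: "pick \<sigma> \<in> \<sigma>" unfolding pick_def using ne by (simp add: some_in_eq)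
  have abs_x: "abs_point x \<in> S" using x abs_point_in_sphere_prod by (simp add: S_def)
  have nz: "\<phi> W (abs_point x) \<noteq> 0 \<longleftrightarrow> W \<in> \<sigma>" if "W \<in> \<W>" for W
    using \<phi>(2)[OF that abs_x] that by (simp add: F_abs \<sigma>_def)
  have "lam l (\<tau> (pick \<sigma>) l) i x = 0" if i: "i < d l" for i
  proof -
    let ?t = "\<lambda>\<sigma>. (\<Prod>W\<in>\<sigma>. \<phi> W (abs_point x)) * lam l (\<tau> (pick \<sigma>) l) i x"
    \<comment> \<open>Another \<open>k\<close>-element set contains some \<open>W\<close> that does not contain \<open>F x\<close>.\<close>
    have "?t \<rho> = 0" if \<rho>: "\<rho> \<subseteq> \<W>" "card \<rho> = k" "\<rho> \<noteq> \<sigma>" for \<rho>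
    proof -
      have "finite \<rho>" using \<rho>(1) \<W>(1) finite_subset by blast
      have "\<not> \<rho> \<subseteq> \<sigma>" using card_subset_eq[OF fin\<sigma>] \<rho> by (auto simp: k_def)
      then obtain W where "W \<in> \<rho>" "W \<notin> \<sigma>" by blast
      then have "\<phi> W (abs_point x) = 0" using nz \<rho>(1) by blast
      then have "(\<Prod>W\<in>\<rho>. \<phi> W (abs_point x)) = 0"
        using \<open>finite \<rho>\<close> \<open>W \<in> \<rho>\<close> by (meson prod_zero)
      then show ?thesis by simp
    qed
    moreover have "finite {\<sigma>. \<sigma> \<subseteq> \<W> \<and> card \<sigma> = k}" using \<W>(1) by simp
    moreover have "\<sigma> \<in> {\<sigma>. \<sigma> \<subseteq> \<W> \<and> card \<sigma> = k}" by (auto simp: \<sigma>_def k_def)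
    ultimately have "h (k, i) x = ?t \<sigma>"
      unfolding h_def split_conv l_def[symmetric]
      by (subst sum.mono_neutral_right[where S = "{\<sigma>}"]) auto
    moreover have "h (k, i) x = 0" using zero k i by (simp add: P_def l_def)
    moreover have "(\<Prod>W\<in>\<sigma>. \<phi> W (abs_point x)) \<noteq> 0"
      using nz fin\<sigma> by (auto simp: \<sigma>_def)
    ultimately show ?thesis by simp
  qed
  then have "F x \<in> F ` K l (\<tau> (pick \<sigma>) l)" using x by (auto simp: K_def)
  moreover have "F x \<in> U (\<tau> (pick \<sigma>))" using pick \<tau> by (auto simp: \<sigma>_def)
  ultimately show False using l by (auto simp: U_def)
qed

end
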